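(* Set $$q=e^{-R\hbar},\qquad Q=(R\Lambda)^2,\qquad x = x(X,R)=e^{R(X-\hbar/2)}.$$ Then $$\lim_{R\to0}Z(x(X,R)) = Z_{\mathrm{4D}}(X),$$ where $$Z_{\mathrm{4D}}(X) = \sum_{\lambda\in\mathcal{P}}\left(\frac{\dim\lambda}{|\lambda|!}\right)^2\left(\frac{\Lambda}{\hbar}\right)^{2|\lambda|}\prod_{i=1}^\infty\frac{X-(\lambda_i-i+1)\hbar}{X-(-i+1)\hbar}.$$
   Context: $\mathcal{P}$ is the set of all partitions $\lambda=(\lambda_1\ge\lambda_2\ge\cdots\ge0)$ with finitely many nonzero parts, $|\lambda|=\sum_i\lambda_i$, and $\dim\lambda$ is the number of standard Young tableaux of shape $\lambda$. $s_\lambda(q^{-\rho})$ is the value of the Schur function $s_\lambda(x_1,x_2,\ldots)$ at $x_i=q^{i-1/2}$, $i=1,2,\ldots$. The function $Z(x)$ (depending also on the parameters $q,Q$) is $$Z(x)=\sum_{\lambda\in\mathcal{P}}s_\lambda(q^{-\rho})^2Q^{|\lambda|}\prod_{i=1}^\infty\frac{1-q^{\lambda_i-i+1/2}x}{1-q^{-i+1/2}x}.$$ The infinite products have only finitely many factors different from $1$. Here $\hbar$ and $\Lambda$ are parameters independent of $R$, with $R>0$ and $\mathrm{Re}\,\hbar>0$ (so $|q|<1$), $q^{1/2}=e^{-R\hbar/2}$, and $X$ is a variable independent of $R$ with $X\notin\{0,-\hbar,-2\hbar,\ldots\}$. *)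

theory Defs
  imports "HOL-Analysis.Analysis"
begin

(* All indices start at 0: l i is the part number i + 1 of the partition, the cell (i, j)
   lies in row i + 1 and column j + 1, and x i is the variable number i + 1. *)

definition partitions :: "(nat \<Rightarrow> nat) set" where
  "partitions = {l. antimono l \<and> finite {i. l i \<noteq> 0}}"

definition psize :: "(nat \<Rightarrow> nat) \<Rightarrow> nat" where
  "psize l = (\<Sum>i | l i \<noteq> 0. l i)"

definition diagram :: "(nat \<Rightarrow> nat) \<Rightarrow> (nat \<times> nat) set" where
  "diagram l = {(i, j). j < l i}"

(* Tableaux are made extensional so that distinct functions are distinct fillings. *)

definition ssyt :: "(nat \<Rightarrow> nat) \<Rightarrow> (nat \<times> nat \<Rightarrow> nat) set" where
  "ssyt l = {T \<in> extensional (diagram l).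
     (\<forall>i j. (i, Suc j) \<in> diagram l \<longrightarrow> T (i, j) \<le> T (i, Suc j)) \<and>
     (\<forall>i j. (Suc i, j) \<in> diagram l \<longrightarrow> T (i, j) < T (Suc i, j))}"

definition syt :: "(nat \<Rightarrow> nat) \<Rightarrow> (nat \<times> nat \<Rightarrow> nat) set" where
  "syt l = {T \<in> extensional (diagram l). bij_betw T (diagram l) {1..psize l} \<and>
     (\<forall>i j. (i, Suc j) \<in> diagram l \<longrightarrow> T (i, j) < T (i, Suc j)) \<and>
     (\<forall>i j. (Suc i, j) \<in> diagram l \<longrightarrow> T (i, j) < T (Suc i, j))}"

definition pdim :: "(nat \<Rightarrow> nat) \<Rightarrow> nat" where
  "pdim l = card (syt l)"

definition schur :: "(nat \<Rightarrow> nat) \<Rightarrow> (nat \<Rightarrow> complex) \<Rightarrow> complex" where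
  "schur l x = (\<Sum>\<^sub>\<infinity>T\<in>ssyt l. \<Prod>c\<in>diagram l. x (T c))"

(* The first argument r is the chosen square root q^(1/2), so that the half-integral powers of q
   are integral powers of r: q^(i-1/2) is r^(2i-1), and q^(l_i-i+1/2) is r^(2(l_i-i)+1). The
   formulas below have i + 1 in place of i. *)

definition Z_term ::
  "complex \<Rightarrow> complex \<Rightarrow> complex \<Rightarrow> (nat \<Rightarrow> nat) \<Rightarrow> complex" where
  "Z_term r Q x l = (schur l (\<lambda>i. r ^ (2 * i + 1)))\<^sup>2 * Q ^ psize l *
     (\<Prod>i. (1 - r powi (2 * (int (l i) - int (i + 1)) + 1) * x) /
           (1 - r powi (2 * (- int (i + 1)) + 1) * x))"

definition Z :: "complex \<Rightarrow> complex \<Rightarrow> complex \<Rightarrow> complex" where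
  "Z r Q x = (\<Sum>\<^sub>\<infinity>l\<in>partitions. Z_term r Q x l)"

definition Z4D_term ::
  "complex \<Rightarrow> complex \<Rightarrow> complex \<Rightarrow> (nat \<Rightarrow> nat) \<Rightarrow> complex" where
  "Z4D_term h \<Lambda> X l = (of_nat (pdim l) / fact (psize l))\<^sup>2 * (\<Lambda> / h) ^ (2 * psize l) *
     (\<Prod>i. (X - of_int (int (l i) - int (i + 1) + 1) * h) /
           (X - of_int (- int (i + 1) + 1) * h))"

definition Z4D :: "complex \<Rightarrow> complex \<Rightarrow> complex \<Rightarrow> complex" where
  "Z4D h \<Lambda> X = (\<Sum>\<^sub>\<infinity>l\<in>partitions. Z4D_term h \<Lambda> X l)"

end

theory Submission imports Defs begin

text \<open>
  The limit is taken termwise by dominated convergence over partitions. In the factor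
  \<open>R^n s\<^sub>\<lambda>(q\<^sup>-\<^sup>\<rho>)\<close>, tableaux with a repeated entry contribute \<open>O(R)\<close>, and all standardizations of
  injective fillings carry the same weight; hence the factor tends to
  \<open>(dim \<lambda> / n!) (1/\<hbar>)^n\<close>, without the hook length formula. For the domination, passing from a
  tableau to its differences along rows, and likewise along columns, bounds
  \<open>|s\<^sub>\<lambda>|\<^sup>2\<close> by the product over the cells of \<open>1 / ((1 - |q|^a) (1 - |q|^b))\<close>, where \<open>a\<close> and \<open>b\<close> are the
  numbers of cells weakly to the right and weakly below. Only \<open>O(sqrt n)\<close> cells have both \<open>a\<close> and \<open>b\<close>
  bounded, so this bound beats every exponential \<open>K^n\<close>, in particular the one that controls the
  product over \<open>i\<close>.
\<close>

section \<open>Generating functions of fillings\<close>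

text \<open>A finite set of functions lies in the finite box spanned by its coordinate projections.
  Over a box the sum of products factors, so every finite partial sum stays below the product of the
  coordinate sums.\<close>

lemma abs_summable_prod_PiE:
  fixes f :: "'a \<Rightarrow> 'b \<Rightarrow> 'c :: {real_normed_field, banach}"
  assumes A: "finite A" and f: "\<And>x. x \<in> A \<Longrightarrow> (\<lambda>y. norm (f x y)) summable_on B x"
  shows "(\<lambda>g. norm (\<Prod>x\<in>A. f x (g x))) summable_on PiE A B"
proof -
  have "(\<Sum>p\<in>P. norm (\<Prod>x\<in>A. f x (p x))) \<le> (\<Prod>x\<in>A. \<Sum>\<^sub>\<infinity>y\<in>B x. norm (f x y))"
    if P: "P \<subseteq> PiE A B" "finite P" for P
  proof -
    define B' where "B' x = (\<lambda>p. p x) ` P" for x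
    have fin: "finite (B' x)" for x
      using P by (simp add: B'_def)
    have sub: "B' x \<subseteq> B x" if "x \<in> A" for x
      using P that by (auto simp: B'_def)
    have "P \<subseteq> PiE A B'"
      using P by (auto simp: B'_def)
    then have "(\<Sum>p\<in>P. norm (\<Prod>x\<in>A. f x (p x))) \<le> (\<Sum>p\<in>PiE A B'. norm (\<Prod>x\<in>A. f x (p x)))"
      using fin A by (intro sum_mono2) (auto intro: finite_PiE)
    also have "\<dots> = (\<Prod>x\<in>A. \<Sum>y\<in>B' x. norm (f x y))"
      using fin A by (simp add: prod_norm[symmetric] prod_sum_PiE)
    also have "\<dots> \<le> (\<Prod>x\<in>A. \<Sum>\<^sub>\<infinity>y\<in>B x. norm (f x y))"
      using fin sub f by (intro prod_mono conjI sum_nonneg finite_sum_le_infsum) auto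
    finally show ?thesis .
  qed
  then show ?thesis
    by (intro nonneg_bdd_above_summable_on bdd_aboveI) auto
qed

text \<open>
  \<open>v i\<close> is recovered from its differences \<open>\<delta> i\<close>, which are arbitrary naturals, so the sum is
  dominated by a product of geometric series.
\<close>

lemma infsum_power_le_prod:
  fixes v \<delta> :: "'i \<Rightarrow> 'd \<Rightarrow> nat" and le :: "'d \<Rightarrow> 'd \<Rightarrow> bool" and z :: real
  assumes z: "0 \<le> z" "z < 1" and D: "finite D"
    and le: "\<And>c. c \<in> D \<Longrightarrow> le c c"
    and inj: "\<And>i j. i \<in> I \<Longrightarrow> j \<in> I \<Longrightarrow> (\<And>c. c \<in> D \<Longrightarrow> v i c = v j c) \<Longrightarrow> i = j"
    and v: "\<And>i c. i \<in> I \<Longrightarrow> c \<in> D \<Longrightarrow> v i c = (\<Sum>b | b \<in> D \<and> le b c. \<delta> i b)"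
  shows "(\<lambda>i. z ^ (\<Sum>c\<in>D. v i c)) summable_on I \<and>
    (\<Sum>\<^sub>\<infinity>i\<in>I. z ^ (\<Sum>c\<in>D. v i c)) \<le> (\<Prod>b\<in>D. 1 / (1 - z ^ card {c \<in> D. le b c}))"
proof -
  define k where "k b = card {c \<in> D. le b c}" for b
  \<comment> \<open>Reflexivity of \<open>le\<close> puts \<open>b\<close> itself into the counted
    set, so the ratio \<open>z ^ k b\<close> of the geometric series is below 1.\<close>
  have k: "k b \<noteq> 0" if "b \<in> D" for b
    using that D le by (auto simp: k_def)
  have zk: "z ^ k b < 1" "0 \<le> z ^ k b" if "b \<in> D" for b
    using z k[OF that] by (auto simp: power_less_one_iff)
  define g where "g i = restrict (\<delta> i) D" for i
  define w where "w f = (\<Prod>b\<in>D. (z ^ k b) ^ f b)" for f :: "'d \<Rightarrow> nat"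
  have geo: "(\<lambda>n. norm ((z ^ k b) ^ n)) summable_on UNIV" "(\<Sum>\<^sub>\<infinity>n. (z ^ k b) ^ n) = 1 / (1 - z ^ k b)"
    if "b \<in> D" for b
  proof -
    have *: "((\<lambda>n. (z ^ k b) ^ n) has_sum (1 / (1 - z ^ k b))) UNIV"
      using zk[OF that] by (intro sums_nonneg_imp_has_sum geometric_sums) auto
    then show "(\<Sum>\<^sub>\<infinity>n. (z ^ k b) ^ n) = 1 / (1 - z ^ k b)"
      by (rule infsumI)
    have "norm ((z ^ k b) ^ n) = (z ^ k b) ^ n" for n
      using z by simp
    then show "(\<lambda>n. norm ((z ^ k b) ^ n)) summable_on UNIV"
      using has_sum_imp_summable[OF *] by simp
  qed
  have w_norm: "(\<lambda>f. norm (w f)) summable_on PiE D (\<lambda>_. UNIV)"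
    unfolding w_def by (rule abs_summable_prod_PiE[OF D]) (rule geo(1))
  then have w_sum: "w summable_on PiE D (\<lambda>_. UNIV)"
    by (rule abs_summable_summable)
  have w_inf: "infsum w (PiE D (\<lambda>_. UNIV)) = (\<Prod>b\<in>D. 1 / (1 - z ^ k b))"
    unfolding w_def by (subst infsum_prod_PiE_abs[OF D geo(1)]) (auto intro: prod.cong geo(2))
  have inj_g: "inj_on g I"
  proof (rule inj_onI)
    fix i j assume ij: "i \<in> I" "j \<in> I" "g i = g j"
    have "\<delta> i b = \<delta> j b" if "b \<in> D" for b
      using ij(3) that by (metis g_def restrict_apply')
    then show "i = j"
      using ij by (intro inj) (auto simp: v intro!: sum.cong)
  qed
  have wg: "z ^ (\<Sum>c\<in>D. v i c) = w (g i)" if "i \<in> I" for i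
  proof -
    \<comment> \<open>Exchange of sums: the difference at \<open>b\<close> is counted once in each
      of the \<open>k b\<close> values \<open>v i c\<close> with \<open>le b c\<close>, so the
      weight factors over the differences.\<close>
    have "(\<Sum>c\<in>D. v i c) = (\<Sum>c\<in>D. \<Sum>b\<in>D. if le b c then \<delta> i b else 0)"
      using that D by (intro sum.cong refl) (simp add: v sum.inter_filter[symmetric])
    also have "\<dots> = (\<Sum>b\<in>D. \<Sum>c\<in>D. if le b c then \<delta> i b else 0)"
      by (rule sum.swap)
    also have "\<dots> = (\<Sum>b\<in>D. k b * \<delta> i b)"
      using D by (intro sum.cong refl) (simp add: k_def sum.inter_filter[symmetric])
    finally have "z ^ (\<Sum>c\<in>D. v i c) = (\<Prod>b\<in>D. (z ^ k b) ^ \<delta> i b)"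
      by (simp add: power_sum power_mult)
    then show ?thesis
      by (simp add: w_def g_def)
  qed
  have sub: "g ` I \<subseteq> PiE D (\<lambda>_. UNIV)"
    by (auto simp: g_def)
  have sg: "w summable_on g ` I"
    using w_sum sub by (rule summable_on_subset_banach)
  then have "(w \<circ> g) summable_on I"
    by (simp add: summable_on_reindex[OF inj_g])
  then have summable: "(\<lambda>i. z ^ (\<Sum>c\<in>D. v i c)) summable_on I"
    by (rule summable_on_cong[THEN iffD1, rotated]) (simp add: wg)
  have "(\<Sum>\<^sub>\<infinity>i\<in>I. z ^ (\<Sum>c\<in>D. v i c)) = infsum (w \<circ> g) I"
    by (rule infsum_cong) (simp add: wg)
  also have "\<dots> = infsum w (g ` I)"
    by (simp add: infsum_reindex[OF inj_g])
  also have "\<dots> \<le> infsum w (PiE D (\<lambda>_. UNIV))"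
    using sg w_sum sub z by (intro infsum_mono2) (auto simp: w_def intro!: prod_nonneg)
  finally show ?thesis
    using summable by (simp add: w_inf k_def)
qed

section \<open>Diagrams, arms and legs\<close>

lemma diagram_iff [simp]: "(i, j) \<in> diagram l \<longleftrightarrow> j < l i"
  by (simp add: diagram_def)

lemma diagram_eq_Sigma: "diagram l = (SIGMA i:{i. l i \<noteq> 0}. {..<l i})"
  by (auto simp: diagram_def)

lemma finite_diagram: "l \<in> partitions \<Longrightarrow> finite (diagram l)"
  by (auto simp: partitions_def diagram_eq_Sigma)

lemma card_diagram: "l \<in> partitions \<Longrightarrow> card (diagram l) = psize l"
  by (auto simp: partitions_def diagram_eq_Sigma psize_def)

lemma partitions_antimonoD: "l \<in> partitions \<Longrightarrow> i \<le> j \<Longrightarrow> l j \<le> l i"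
  by (simp add: partitions_def antimonoD)

text \<open>Here arm and leg include the cell itself, so they exceed the usual ones by 1.\<close>

definition arm :: "(nat \<Rightarrow> nat) \<Rightarrow> nat \<times> nat \<Rightarrow> nat" where
  "arm l b = card {c \<in> diagram l. fst b = fst c \<and> snd b \<le> snd c}"

definition leg :: "(nat \<Rightarrow> nat) \<Rightarrow> nat \<times> nat \<Rightarrow> nat" where
  "leg l b = card {c \<in> diagram l. snd b = snd c \<and> fst b \<le> fst c}"

lemma arm_eq: "arm l (i, j) = l i - j"
proof -
  have "{c \<in> diagram l. i = fst c \<and> j \<le> snd c} = Pair i ` {j..<l i}"
    by auto
  then show ?thesis
    by (simp add: arm_def card_image inj_on_def)
qed

text \<open>\<open>c\<close> is the conjugate partition: the length of column \<open>j\<close> is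
  the index of the first row with at most \<open>j\<close> cells. Finite support makes such a row
  exist, and monotonicity makes the column an initial segment.\<close>

lemma leg_conjugateE:
  assumes "l \<in> partitions"
  obtains c where "\<And>i j. leg l (i, j) = c j - i" "\<And>i j. j < l i \<longleftrightarrow> i < (c j :: nat)"
proof -
  define c where "c j = (LEAST i. l i \<le> j)" for j
  have fin: "finite {i. l i \<noteq> 0}" and anti: "antimono l"
    using assms by (auto simp: partitions_def)
  have *: "j < l i \<longleftrightarrow> i < c j" for i j
  proof -
    obtain i0 where "l i0 = 0"
      using ex_new_if_finite[OF _ fin] by auto
    then have "l (c j) \<le> j"
      unfolding c_def using LeastI[of "\<lambda>i. l i \<le> j" i0] by simp
    moreover have "c j \<le> i \<Longrightarrow> l i \<le> l (c j)"
      using anti by (rule antimonoD)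
    ultimately show ?thesis
      using not_less_Least[of i "\<lambda>i. l i \<le> j"] unfolding c_def[symmetric] by linarith
  qed
  have "{b \<in> diagram l. j = snd b \<and> i \<le> fst b} = (\<lambda>i. (i, j)) ` {i..<c j}" for i j
    using * by auto
  then have "leg l (i, j) = c j - i" for i j
    by (simp add: leg_def card_image inj_on_def)
  then show ?thesis
    using that * by blast
qed

text \<open>The first difference is \<open>f 0\<close> itself, so the sum telescopes without
  remainder; monotonicity keeps the natural subtraction from truncating.\<close>

lemma sum_differences_nat:
  fixes f :: "nat \<Rightarrow> nat"
  assumes "\<And>k. k < j \<Longrightarrow> f k \<le> f (Suc k)"
  shows "(\<Sum>k\<le>j. f k - (if k = 0 then 0 else f (k - 1))) = f j"
  using assms
proof (induction j)
  case (Suc j)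
  then have "f j \<le> f (Suc j)"
    by simp
  then show ?case
    using Suc by simp
qed simp

lemma ssyt_eqI:
  "S \<in> ssyt l \<Longrightarrow> T \<in> ssyt l \<Longrightarrow> (\<And>c. c \<in> diagram l \<Longrightarrow> S c = T c) \<Longrightarrow> S = T"
  by (auto simp: ssyt_def intro: extensionalityI)

text \<open>Rows increase weakly, so the row differences determine a tableau. The difference at
  \<open>b\<close> enters every entry weakly to the right of \<open>b\<close> in its row, which are
  \<open>arm l b\<close> many.\<close>

lemma infsum_ssyt_le_arm:
  fixes z :: real
  assumes l: "l \<in> partitions" and z: "0 \<le> z" "z < 1"
  shows "(\<lambda>T. z ^ (\<Sum>c\<in>diagram l. T c)) summable_on ssyt l \<and>
    (\<Sum>\<^sub>\<infinity>T\<in>ssyt l. z ^ (\<Sum>c\<in>diagram l. T c)) \<le> (\<Prod>b\<in>diagram l. 1 / (1 - z ^ arm l b))"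
  unfolding arm_def
proof (rule infsum_power_le_prod[OF z finite_diagram[OF l], where \<delta> = "\<lambda>T (i, j). T (i, j) - (if j = 0 then 0 else T (i, j - 1))"])
  fix T c assume T: "T \<in> ssyt l" and c: "c \<in> diagram l"
  obtain i j where ij: "c = (i, j)" "j < l i"
    using c by (cases c) auto
  have "(\<Sum>b | b \<in> diagram l \<and> fst b = fst c \<and> snd b \<le> snd c. case b of (i, j) \<Rightarrow> T (i, j) - (if j = 0 then 0 else T (i, j - 1)))
    = (\<Sum>k\<le>j. T (i, k) - (if k = 0 then 0 else T (i, k - 1)))"
    using ij by (intro sum.reindex_bij_witness[of _ "\<lambda>k. (i, k)" snd]) auto
  also have "\<dots> = T (i, j)"
    using T ij by (intro sum_differences_nat) (auto simp: ssyt_def)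
  finally show "T c = (\<Sum>b | b \<in> diagram l \<and> fst b = fst c \<and> snd b \<le> snd c. case b of (i, j) \<Rightarrow> T (i, j) - (if j = 0 then 0 else T (i, j - 1)))"
    by (simp add: ij)
qed (auto intro: ssyt_eqI)

text \<open>The column analogue: the difference at \<open>b\<close> enters the
  \<open>leg l b\<close> entries weakly below it.\<close>

lemma infsum_ssyt_le_leg:
  fixes z :: real
  assumes l: "l \<in> partitions" and z: "0 \<le> z" "z < 1"
  shows "(\<lambda>T. z ^ (\<Sum>c\<in>diagram l. T c)) summable_on ssyt l \<and>
    (\<Sum>\<^sub>\<infinity>T\<in>ssyt l. z ^ (\<Sum>c\<in>diagram l. T c)) \<le> (\<Prod>b\<in>diagram l. 1 / (1 - z ^ leg l b))"
  unfolding leg_def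
proof (rule infsum_power_le_prod[OF z finite_diagram[OF l], where \<delta> = "\<lambda>T (i, j). T (i, j) - (if i = 0 then 0 else T (i - 1, j))"])
  fix T c assume T: "T \<in> ssyt l" and c: "c \<in> diagram l"
  obtain i j where ij: "c = (i, j)" "j < l i"
    using c by (cases c) auto
  have up: "j < l k" if "k \<le> i" for k
    using partitions_antimonoD[OF l that] ij by simp
  have "(\<Sum>b | b \<in> diagram l \<and> snd b = snd c \<and> fst b \<le> fst c. case b of (i, j) \<Rightarrow> T (i, j) - (if i = 0 then 0 else T (i - 1, j)))
    = (\<Sum>k\<le>i. T (k, j) - (if k = 0 then 0 else T (k - 1, j)))"
    using ij up by (intro sum.reindex_bij_witness[of _ "\<lambda>k. (k, j)" fst]) auto
  also have "\<dots> = T (i, j)"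
    using T up by (intro sum_differences_nat) (auto simp: ssyt_def intro!: less_imp_le)
  finally show "T c = (\<Sum>b | b \<in> diagram l \<and> snd b = snd c \<and> fst b \<le> fst c. case b of (i, j) \<Rightarrow> T (i, j) - (if i = 0 then 0 else T (i - 1, j)))"
    by (simp add: ij)
qed (auto intro: ssyt_eqI)

text \<open>Let \<open>s\<close> be the square root of the size, rounded up. A cell outside the
  first \<open>s\<close> rows and the first \<open>s\<close> columns would span a rectangle of more
  than \<open>s * s\<close> cells inside the diagram. So every cell lies in one of \<open>s\<close>
  rows or \<open>s\<close> columns, and a short arm or leg confines it to the last \<open>H\<close>
  cells there.\<close>

lemma card_small_arm_leg:
  assumes l: "l \<in> partitions"
  shows "real (card {b \<in> diagram l. arm l b < H \<and> leg l b < H}) \<le> 2 * H * (sqrt (psize l) + 1)"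
proof -
  obtain c where c: "\<And>i j. leg l (i, j) = c j - i" "\<And>i j. j < l i \<longleftrightarrow> i < (c j :: nat)"
    using leg_conjugateE[OF l] by blast
  define s where "s = nat \<lceil>sqrt (psize l)\<rceil>"
  have s: "psize l \<le> s * s" "real s \<le> sqrt (psize l) + 1"
  proof -
    have "sqrt (psize l) \<le> real s"
      unfolding s_def by linarith
    then have "real (psize l) \<le> (real s)\<^sup>2"
      using real_le_lsqrt by (metis real_sqrt_le_iff real_sqrt_unique sqrt_le_D)
    then show "psize l \<le> s * s"
      by (simp add: power2_eq_square flip: of_nat_mult)
    show "real s \<le> sqrt (psize l) + 1"
      unfolding s_def using real_sqrt_ge_zero[of "psize l"] by linarith
  qed
  have "{b \<in> diagram l. arm l b < H \<and> leg l b < H} \<subseteq>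
    (SIGMA i:{..<s}. {l i - H..<l i}) \<union> (\<lambda>(j, i). (i, j)) ` (SIGMA j:{..<s}. {c j - H..<c j})"
    (is "?A \<subseteq> ?B \<union> ?C")
  proof
    fix b assume b: "b \<in> ?A"
    obtain i j where ij: "b = (i, j)"
      by (cases b)
    have "i < s \<or> j < s"
    proof (rule ccontr)
      assume *: "\<not> (i < s \<or> j < s)"
      have "{..i} \<times> {..j} \<subseteq> diagram l"
      proof (clarsimp)
        fix i' j' assume "i' \<le> i" "j' \<le> j"
        then show "j' < l i'"
          using b ij partitions_antimonoD[OF l, of i' i] by auto
      qed
      then have "card ({..i} \<times> {..j}) \<le> psize l"
        using card_mono finite_diagram[OF l] card_diagram[OF l] by metis
      then have "Suc i * Suc j \<le> s * s"
        using s by (simp add: card_cartesian_product)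
      moreover have "s * s < Suc i * Suc j"
        using * by (intro mult_strict_mono) auto
      ultimately show False
        by simp
    qed
    then show "b \<in> ?B \<union> ?C"
      using b ij c by (force simp: arm_eq image_iff)
  qed
  moreover have "finite (?B \<union> ?C)"
    by auto
  ultimately have "card ?A \<le> card ?B + card ?C"
    by (meson card_Un_le card_mono le_trans)
  also have "card ?C \<le> card (SIGMA j:{..<s}. {c j - H..<c j})"
    by (rule card_image_le) auto
  also have "card ?B + card (SIGMA j:{..<s}. {c j - H..<c j}) \<le> s * H + s * H"
    by (simp, intro add_mono order.trans[OF sum_bounded_above[where K = H]]) auto
  finally have "real (card ?A) \<le> 2 * H * real s"
    by (simp add: algebra_simps flip: of_nat_mult)
  also have "\<dots> \<le> 2 * H * (sqrt (psize l) + 1)"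
    using s by (intro mult_left_mono) auto
  finally show ?thesis
    by simp
qed

section \<open>Standardization\<close>

text \<open>Entries are replaced by their ranks, counted from 1 because \<open>c\<close> itself is
  included. Equal entries share a rank, so only injective fillings yield a bijection onto
  \<open>{1..card D}\<close>.\<close>

definition standardization :: "'a set \<Rightarrow> ('a \<Rightarrow> nat) \<Rightarrow> 'a \<Rightarrow> nat" where
  "standardization D f = (\<lambda>c\<in>D. card {b \<in> D. f b \<le> f c})"

lemma standardization_less_iff:
  assumes "finite D" "c \<in> D" "d \<in> D"
  shows "standardization D f c < standardization D f d \<longleftrightarrow> f c < f d"
proof -
  have less: "card {b \<in> D. f b \<le> f c} < card {b \<in> D. f b \<le> f d}" if "f c < f d" "d \<in> D" for c d
    using that assms(1) by (intro psubset_card_mono) (auto simp: psubset_eq set_eq_iff intro!: exI[of _ d])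
  show ?thesis
  proof (cases "f c < f d")
    case True
    then show ?thesis
      using less[of c d] assms by (simp add: standardization_def)
  next
    case False
    then have "card {b \<in> D. f b \<le> f d} \<le> card {b \<in> D. f b \<le> f c}"
      using assms(1) by (intro card_mono) auto
    then show ?thesis
      using False assms by (simp add: standardization_def)
  qed
qed

lemma bij_betw_standardization:
  assumes D: "finite D" and f: "inj_on f D"
  shows "bij_betw (standardization D f) D {1..card D}"
proof -
  have inj: "inj_on (standardization D f) D"
    by (intro inj_onI) (metis D f inj_onD less_irrefl linorder_neqE_nat standardization_less_iff)
  have "standardization D f c \<in> {1..card D}" if "c \<in> D" for c
  proof -
    have "{b \<in> D. f b \<le> f c} \<noteq> {}"
      using that by blast
    then have "card {b \<in> D. f b \<le> f c} > 0"
      using D by (simp add: card_gt_0_iff)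
    moreover have "card {b \<in> D. f b \<le> f c} \<le> card D"
      using D by (intro card_mono) auto
    ultimately show ?thesis
      using that by (simp add: standardization_def)
  qed
  then have "standardization D f ` D = {1..card D}"
    using card_image[OF inj] by (intro card_subset_eq) auto
  with inj show ?thesis
    by (simp add: bij_betw_def)
qed

lemma standardization_compose:
  assumes "bij_betw \<pi> D D"
  shows "standardization D (\<lambda>c\<in>D. f (\<pi> c)) = (\<lambda>c\<in>D. standardization D f (\<pi> c))"
proof
  fix c
  show "standardization D (\<lambda>c\<in>D. f (\<pi> c)) c = (\<lambda>c\<in>D. standardization D f (\<pi> c)) c"
  proof (cases "c \<in> D")
    case True
    then have "\<pi> c \<in> D"
      using assms by (rule bij_betwE[THEN bspec, rotated])
    have "bij_betw \<pi> {b \<in> D. f (\<pi> b) \<le> f (\<pi> c)} {b \<in> D. f b \<le> f (\<pi> c)}"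
      using assms by (auto simp: bij_betw_def inj_on_def)
    then have "card {b \<in> D. f (\<pi> b) \<le> f (\<pi> c)} = card {b \<in> D. f b \<le> f (\<pi> c)}"
      by (rule bij_betw_same_card)
    moreover have "{b \<in> D. (\<lambda>c\<in>D. f (\<pi> c)) b \<le> f (\<pi> c)} = {b \<in> D. f (\<pi> b) \<le> f (\<pi> c)}"
      by auto
    ultimately show ?thesis
      using True \<open>\<pi> c \<in> D\<close> by (simp add: standardization_def)
  qed (simp add: standardization_def)
qed

definition labellings :: "'a set \<Rightarrow> ('a \<Rightarrow> nat) set" where
  "labellings D = {s \<in> extensional D. bij_betw s D {1..card D}}"

lemma finite_labellings: "finite D \<Longrightarrow> finite (labellings D)"
  and card_labellings: "finite D \<Longrightarrow> card (labellings D) = fact (card D)"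
proof -
  assume D: "finite D"
  have eq: "labellings D = {s \<in> D \<rightarrow>\<^sub>E {1..card D}. inj_on s D}"
  proof (intro set_eqI iffI)
    fix s assume "s \<in> labellings D"
    then show "s \<in> {s \<in> D \<rightarrow>\<^sub>E {1..card D}. inj_on s D}"
      by (auto simp: labellings_def bij_betw_def PiE_def)
  next
    fix s assume s: "s \<in> {s \<in> D \<rightarrow>\<^sub>E {1..card D}. inj_on s D}"
    then have "s ` D = {1..card D}"
      using card_image[of s D] by (intro card_subset_eq) auto
    with s show "s \<in> labellings D"
      by (auto simp: labellings_def bij_betw_def PiE_def)
  qed
  have "finite (D \<rightarrow>\<^sub>E {1..card D})"
    using D by (intro finite_PiE) auto
  then show "finite (labellings D)"
    unfolding eq by simp
  show "card (labellings D) = fact (card D)"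
    unfolding eq using D by (simp add: card_inj_on_subset_funcset fact_prod_rev)
qed

lemma standardization_in_labellings:
  "finite D \<Longrightarrow> inj_on f D \<Longrightarrow> standardization D f \<in> labellings D"
  using bij_betw_standardization by (auto simp: labellings_def standardization_def)

text \<open>These classes partition the injective fillings; for a diagram, the injective
  semistandard fillings are exactly the classes whose \<open>s\<close> is a standard
  tableau.\<close>

definition std_class :: "'a set \<Rightarrow> ('a \<Rightarrow> nat) \<Rightarrow> ('a \<Rightarrow> nat) set" where
  "std_class D s = {f \<in> extensional D. inj_on f D \<and> standardization D f = s}"

text \<open>A permutation of the cells carries one class to the other and preserves the weight.\<close>

lemma infsum_std_class_eq:
  fixes x :: "nat \<Rightarrow> complex"
  assumes s: "s \<in> labellings D" and t: "t \<in> labellings D"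
  shows "(\<Sum>\<^sub>\<infinity>f\<in>std_class D s. \<Prod>c\<in>D. x (f c)) = (\<Sum>\<^sub>\<infinity>f\<in>std_class D t. \<Prod>c\<in>D. x (f c))"
proof -
  have bs: "bij_betw s D {1..card D}" and bt: "bij_betw t D {1..card D}"
    and ext: "s \<in> extensional D" "t \<in> extensional D"
    using s t by (auto simp: labellings_def)
  \<comment> \<open>The permutation is forced by \<open>s (\<pi> c) = t c\<close>: it sends the cell
    with a given label in \<open>t\<close> to the cell with that label in \<open>s\<close>.
    \<open>\<rho>\<close> is its inverse on \<open>D\<close>.\<close>
  define \<pi> where "\<pi> = the_inv_into D s \<circ> t"
  define \<rho> where "\<rho> = the_inv_into D t \<circ> s"
  have \<pi>: "bij_betw \<pi> D D"
    unfolding \<pi>_def by (rule bij_betw_trans[OF bt bij_betw_the_inv_into[OF bs]])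
  have \<rho>: "bij_betw \<rho> D D"
    unfolding \<rho>_def by (rule bij_betw_trans[OF bs bij_betw_the_inv_into[OF bt]])
  have s\<pi>: "s (\<pi> c) = t c" if "c \<in> D" for c
    using f_the_inv_into_f_bij_betw[OF bs] bij_betwE[OF bt] that by (simp add: \<pi>_def)
  have t\<rho>: "t (\<rho> c) = s c" if "c \<in> D" for c
    using f_the_inv_into_f_bij_betw[OF bt] bij_betwE[OF bs] that by (simp add: \<rho>_def)
  have \<pi>D: "\<pi> c \<in> D" and \<rho>D: "\<rho> c \<in> D" if "c \<in> D" for c
    using that \<pi> \<rho> by (auto dest: bij_betwE)
  have \<pi>\<rho>: "\<pi> (\<rho> c) = c" if "c \<in> D" for c
    using s\<pi>[OF \<rho>D[OF that]] t\<rho>[OF that] bij_betw_imp_inj_on[OF bs] \<pi>D[OF \<rho>D[OF that]] that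
    by (auto dest: inj_onD)
  have \<rho>\<pi>: "\<rho> (\<pi> c) = c" if "c \<in> D" for c
    using t\<rho>[OF \<pi>D[OF that]] s\<pi>[OF that] bij_betw_imp_inj_on[OF bt] \<rho>D[OF \<pi>D[OF that]] that
    by (auto dest: inj_onD)
  have relabel: "(\<lambda>c\<in>D. f (p c)) \<in> std_class D v"
    if f: "f \<in> std_class D u" and p: "bij_betw p D D" and up: "\<And>c. c \<in> D \<Longrightarrow> u (p c) = v c"
      and v: "v \<in> extensional D" for f p u v
  proof -
    have "inj_on (f \<circ> p) D"
      using f p by (intro comp_inj_on) (auto simp: std_class_def bij_betw_def)
    then have "inj_on (\<lambda>c\<in>D. f (p c)) D"
      by (simp add: inj_on_def)
    moreover have "standardization D (\<lambda>c\<in>D. f (p c)) = v"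
      unfolding standardization_compose[OF p] using f up v
      by (auto simp: std_class_def fun_eq_iff extensional_def)
    ultimately show ?thesis
      by (simp add: std_class_def)
  qed
  show ?thesis
  proof (rule infsum_reindex_bij_witness[of _ "\<lambda>f. \<lambda>c\<in>D. f (\<rho> c)" "\<lambda>f. \<lambda>c\<in>D. f (\<pi> c)"])
    fix f assume f: "f \<in> std_class D s"
    then show "(\<lambda>c\<in>D. f (\<pi> c)) \<in> std_class D t"
      using \<pi> s\<pi> ext by (rule_tac relabel)
    show "(\<lambda>c\<in>D. (\<lambda>c\<in>D. f (\<pi> c)) (\<rho> c)) = f"
      using f \<rho>D \<pi>\<rho> by (auto simp: std_class_def fun_eq_iff extensional_def)
    show "(\<Prod>c\<in>D. x ((\<lambda>c\<in>D. f (\<pi> c)) c)) = (\<Prod>c\<in>D. x (f c))"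
      using prod.reindex_bij_betw[OF \<pi>, of "\<lambda>c. x (f c)"] by simp
  next
    fix f assume f: "f \<in> std_class D t"
    then show "(\<lambda>c\<in>D. f (\<rho> c)) \<in> std_class D s"
      using \<rho> t\<rho> ext by (rule_tac relabel)
    show "(\<lambda>c\<in>D. (\<lambda>c\<in>D. f (\<rho> c)) (\<pi> c)) = f"
      using f \<pi>D \<rho>\<pi> by (auto simp: std_class_def fun_eq_iff extensional_def)
  qed
qed

text \<open>Union bound for overlapping sets: each new set contributes only its part outside the
  earlier union.\<close>

lemma infsum_UN_le:
  fixes g :: "'a \<Rightarrow> real"
  assumes "finite A" "\<And>a. a \<in> A \<Longrightarrow> g summable_on B a" "\<And>y. 0 \<le> g y"
  shows "g summable_on (\<Union>a\<in>A. B a) \<and> infsum g (\<Union>a\<in>A. B a) \<le> (\<Sum>a\<in>A. infsum g (B a))"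
  using assms(1,2)
proof (induction A)
  case (insert a A)
  let ?U = "\<Union>a\<in>A. B a"
  have U: "g summable_on ?U" "infsum g ?U \<le> (\<Sum>a\<in>A. infsum g (B a))" and Ba: "g summable_on B a"
    using insert by auto
  have diff: "g summable_on (B a - ?U)"
    using Ba by (rule summable_on_subset_banach) auto
  have eq: "(\<Union>a\<in>insert a A. B a) = ?U \<union> (B a - ?U)"
    by auto
  have "infsum g (?U \<union> (B a - ?U)) = infsum g ?U + infsum g (B a - ?U)"
    using U diff by (intro infsum_Un_disjoint) auto
  moreover have "infsum g (B a - ?U) \<le> infsum g (B a)"
    using diff Ba assms(3) by (intro infsum_mono2) auto
  ultimately show ?case
    unfolding eq using U insert.hyps summable_on_Un_disjoint[OF U(1) diff] by auto
qed auto

text \<open>A non-injective filling agrees on some pair of distinct cells \<open>c\<close>,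
  \<open>d\<close>, and there are at most \<open>card D ^ 2\<close> pairs. For a fixed pair the
  value at \<open>c\<close> repeats the one at \<open>d\<close>, so dropping it loses no information
  and costs only a factor \<open>x (f c) \<le> 1\<close>; one summation fewer remains than there are
  cells.\<close>

lemma infsum_noninjective_le:
  fixes x :: "nat \<Rightarrow> real"
  assumes D: "finite D" and x: "x summable_on UNIV" "\<And>i. 0 \<le> x i" "\<And>i. x i \<le> 1"
  shows "(\<Sum>\<^sub>\<infinity>f\<in>{f \<in> extensional D. \<not> inj_on f D}. \<Prod>c\<in>D. x (f c)) \<le> real (card D ^ 2) * infsum x UNIV ^ (card D - 1)"
proof -
  define w where "w = (\<lambda>f. \<Prod>c\<in>D. x (f c))"
  define G :: "'a \<times> 'a \<Rightarrow> ('a \<Rightarrow> nat) set" where "G = (\<lambda>(c, d). {f \<in> extensional D. f c = f d})"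
  define P where "P = {(c, d) \<in> D \<times> D. c \<noteq> d}"
  have nx: "(\<lambda>i. norm (x i)) summable_on UNIV"
    using x by simp
  have sum: "(\<lambda>f. \<Prod>c\<in>E. x (f c)) summable_on extensional E" if "finite E" for E :: "'a set"
    using abs_summable_summable[OF abs_summable_prod_PiE[OF that nx]] by (simp add: PiE_def)
  have w0: "0 \<le> w f" for f
    using x by (simp add: w_def prod_nonneg)
  have G: "w summable_on G a \<and> infsum w (G a) \<le> infsum x UNIV ^ (card D - 1)" if a: "a \<in> P" for a
  proof -
    obtain c d where cd: "a = (c, d)" "c \<in> D" "d \<in> D" "c \<noteq> d"
      using a by (auto simp: P_def)
    let ?E = "D - {c}"
    define w' where "w' = (\<lambda>f. \<Prod>b\<in>?E. x (f b))"
    define r where "r f = (restrict f ?E :: 'a \<Rightarrow> nat)" for f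
    have inj: "inj_on r (G a)"
    proof (rule inj_onI)
      fix f g assume fg: "f \<in> G a" "g \<in> G a" "r f = r g"
      have E: "f b = g b" if "b \<in> ?E" for b
        using fg(3) that by (metis r_def restrict_apply')
      moreover have "f c = g c"
        using E[of d] fg cd by (simp add: G_def)
      ultimately show "f = g"
        using fg by (intro extensionalityI[of _ D]) (auto simp: G_def)
    qed
    have sw: "w summable_on G a"
      using sum[OF D] unfolding w_def by (rule summable_on_subset_banach) (auto simp: G_def cd)
    have sw': "w' summable_on extensional ?E"
      unfolding w'_def using D by (intro sum) auto
    have sub: "r ` G a \<subseteq> extensional ?E"
      by (auto simp: r_def)
    have sr: "w' summable_on r ` G a"
      using sw' sub by (rule summable_on_subset_banach)
    have "infsum w (G a) \<le> infsum (w' \<circ> r) (G a)"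
    proof (rule infsum_mono)
      show "w summable_on G a" by (rule sw)
      show "(w' \<circ> r) summable_on G a"
        using sr by (simp add: summable_on_reindex[OF inj])
      fix f
      have "w f = x (f c) * w' (r f)"
        using D cd by (simp add: w_def w'_def r_def prod.remove)
      also have "\<dots> \<le> 1 * w' (r f)"
        using x by (intro mult_right_mono) (auto simp: w'_def prod_nonneg)
      finally show "w f \<le> (w' \<circ> r) f"
        by simp
    qed
    also have "\<dots> = infsum w' (r ` G a)"
      by (simp add: infsum_reindex[OF inj])
    also have "\<dots> \<le> infsum w' (extensional ?E)"
      using sr sw' sub x by (intro infsum_mono2) (auto simp: w'_def prod_nonneg)
    also have "\<dots> = (\<Sum>\<^sub>\<infinity>f\<in>PiE ?E (\<lambda>_. UNIV). w' f)"
      by (simp add: PiE_def)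
    also have "\<dots> = infsum x UNIV ^ (card D - 1)"
      unfolding w'_def using D nx cd by (subst infsum_prod_PiE_abs) auto
    finally show ?thesis
      using sw by simp
  qed
  have finP: "finite P"
    using D by (auto simp: P_def intro: finite_subset[of _ "D \<times> D"])
  have eq: "{f \<in> extensional D. \<not> inj_on f D} = (\<Union>a\<in>P. G a)"
    by (auto simp: P_def G_def inj_on_def)
  have "infsum w (\<Union>a\<in>P. G a) \<le> (\<Sum>a\<in>P. infsum w (G a))"
    using infsum_UN_le[OF finP, of w G] G w0 by blast
  also have "\<dots> \<le> (\<Sum>a\<in>P. infsum x UNIV ^ (card D - 1))"
    using G by (intro sum_mono) auto
  also have "\<dots> = real (card P) * infsum x UNIV ^ (card D - 1)"
    by simp
  also have "\<dots> \<le> real (card D ^ 2) * infsum x UNIV ^ (card D - 1)"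
  proof -
    have "card P \<le> card (D \<times> D)"
      using D by (intro card_mono) (auto simp: P_def)
    then have "real (card P) \<le> real (card D ^ 2)"
      by (simp only: card_cartesian_product power2_eq_square of_nat_le_iff)
    then show ?thesis
      using x by (intro mult_right_mono zero_le_power infsum_nonneg) auto
  qed
  finally show ?thesis
    unfolding eq w_def .
qed

section \<open>Schur functions compared with powers of the first power sum\<close>

lemma syt_subset_labellings: "l \<in> partitions \<Longrightarrow> syt l \<subseteq> labellings (diagram l)"
  by (auto simp: syt_def labellings_def card_diagram)

lemma pdim_le_fact:
  assumes "l \<in> partitions"
  shows "pdim l \<le> fact (psize l)"
  unfolding pdim_def using assms
  by (metis card_diagram card_labellings card_mono finite_diagram finite_labellings syt_subset_labellings)

text \<open>Standardization preserves and reflects strict order, which settles the columns. In rows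
  the entries are distinct, so weak and strict increase coincide.\<close>

lemma standardization_in_syt_iff:
  assumes l: "l \<in> partitions" and f: "f \<in> extensional (diagram l)" "inj_on f (diagram l)"
  shows "standardization (diagram l) f \<in> syt l \<longleftrightarrow> f \<in> ssyt l"
proof -
  let ?s = "standardization (diagram l) f"
  have s: "?s \<in> extensional (diagram l)" "bij_betw ?s (diagram l) {1..psize l}"
    using standardization_in_labellings[OF finite_diagram[OF l] f(2)] l
    by (auto simp: labellings_def card_diagram)
  have right: "?s (i, j) < ?s (i, Suc j) \<longleftrightarrow> f (i, j) \<le> f (i, Suc j)" if "Suc j < l i" for i j
  proof -
    have "f (i, j) \<noteq> f (i, Suc j)"
      using inj_onD[OF f(2), of "(i, j)" "(i, Suc j)"] that by auto
    then show ?thesis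
      using that by (subst standardization_less_iff[OF finite_diagram[OF l]]) auto
  qed
  have down: "?s (i, j) < ?s (Suc i, j) \<longleftrightarrow> f (i, j) < f (Suc i, j)" if "j < l (Suc i)" for i j
    using that partitions_antimonoD[OF l, of i "Suc i"]
    by (intro standardization_less_iff[OF finite_diagram[OF l]]) auto
  show ?thesis
    using s f by (simp add: syt_def ssyt_def right down)
qed

text \<open>\<open>infsum x UNIV ^ n\<close> is the total weight of all fillings,
  \<open>schur l x\<close> that of the semistandard ones. Their injective parts consist of
  \<open>fact n\<close> and \<open>pdim l\<close> classes of equal weight \<open>e\<close>, so only
  the non-injective fillings cause an error.\<close>

lemma norm_schur_diff_le:
  fixes x :: "nat \<Rightarrow> complex"
  assumes l: "l \<in> partitions"
    and x: "(\<lambda>i. norm (x i)) summable_on UNIV" "\<And>i. norm (x i) \<le> 1"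
  defines "n \<equiv> psize l"
  shows "norm (schur l x - of_nat (pdim l) / fact n * infsum x UNIV ^ n)
    \<le> 2 * real (n ^ 2) * (\<Sum>\<^sub>\<infinity>i. norm (x i)) ^ (n - 1)"
proof -
  define D where "D = diagram l"
  have D: "finite D" "card D = n"
    using l by (simp_all add: D_def n_def finite_diagram card_diagram)
  define w where "w = (\<lambda>f. \<Prod>c\<in>D. x (f c))"
  define Q :: "(nat \<times> nat \<Rightarrow> nat) set" where "Q = {f \<in> extensional D. \<not> inj_on f D}"
  define B where "B = real (n ^ 2) * (\<Sum>\<^sub>\<infinity>i. norm (x i)) ^ (n - 1)"
  have PiE: "PiE D (\<lambda>_. UNIV) = (extensional D :: (nat \<times> nat \<Rightarrow> nat) set)"
    by (simp add: PiE_def)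
  have nw: "(\<lambda>f. norm (w f)) summable_on extensional D"
    using abs_summable_prod_PiE[OF D(1) x(1)] by (simp add: PiE w_def)
  have nw_sub: "(\<lambda>f. norm (w f)) summable_on F" if "F \<subseteq> extensional D" for F
    using nw that by (rule summable_on_subset_banach)
  have w_sub: "w summable_on F" if "F \<subseteq> extensional D" for F
    using nw_sub[OF that] by (rule abs_summable_summable)
  have Q: "(\<Sum>\<^sub>\<infinity>f\<in>Q. norm (w f)) \<le> B"
    using infsum_noninjective_le[OF D(1), of "\<lambda>i. norm (x i)"] x
    by (simp add: Q_def w_def B_def prod_norm[symmetric] D)
  have small: "norm (infsum w F) \<le> B" if "F \<subseteq> Q" for F
  proof -
    have "F \<subseteq> extensional D" "Q \<subseteq> extensional D"
      using that by (auto simp: Q_def)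
    then have "norm (infsum w F) \<le> (\<Sum>\<^sub>\<infinity>f\<in>F. norm (w f))" "(\<Sum>\<^sub>\<infinity>f\<in>F. norm (w f)) \<le> (\<Sum>\<^sub>\<infinity>f\<in>Q. norm (w f))"
      using that by (auto intro!: norm_infsum_bound infsum_mono2 nw_sub)
    with Q show ?thesis
      by linarith
  qed
  obtain e where e: "\<And>s. s \<in> labellings D \<Longrightarrow> infsum w (std_class D s) = e"
    using infsum_std_class_eq[of _ D _ x] unfolding w_def by metis
  have class_sum: "infsum w (\<Union>s\<in>S. std_class D s) = of_nat (card S) * e" if S: "S \<subseteq> labellings D" for S
  proof -
    have "finite S"
      using S finite_labellings[OF D(1)] by (rule finite_subset)
    then have "infsum w (\<Union>s\<in>S. std_class D s) = (\<Sum>s\<in>S. infsum w (std_class D s))"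
      by (intro sum_infsum[symmetric] w_sub) (auto simp: std_class_def)
    also have "\<dots> = (\<Sum>s\<in>S. e)"
      using S e by (intro sum.cong) auto
    finally show ?thesis
      by simp
  qed
  have split: "infsum w F = infsum w {f \<in> F. inj_on f D} + infsum w {f \<in> F. \<not> inj_on f D}"
    if "F \<subseteq> extensional D" for F
  proof -
    have "infsum w ({f \<in> F. inj_on f D} \<union> {f \<in> F. \<not> inj_on f D}) =
        infsum w {f \<in> F. inj_on f D} + infsum w {f \<in> F. \<not> inj_on f D}"
      using that by (intro infsum_Un_disjoint w_sub) auto
    moreover have "{f \<in> F. inj_on f D} \<union> {f \<in> F. \<not> inj_on f D} = F"
      by auto
    ultimately show ?thesis
      by simp
  qed
  have ssyt: "ssyt l \<subseteq> extensional D"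
    by (auto simp: ssyt_def D_def)
  have "{f \<in> ssyt l. inj_on f D} = (\<Union>s\<in>syt l. std_class D s)"
    using standardization_in_syt_iff[OF l] ssyt by (auto simp: std_class_def D_def)
  then have 1: "infsum w {f \<in> ssyt l. inj_on f D} = of_nat (pdim l) * e"
    using class_sum[of "syt l"] syt_subset_labellings[OF l] by (simp add: pdim_def D_def)
  have "{f \<in> extensional D. inj_on f D} = (\<Union>s\<in>labellings D. std_class D s)"
    using standardization_in_labellings[OF D(1)] by (auto simp: std_class_def)
  then have 2: "infsum w {f \<in> extensional D. inj_on f D} = fact n * e"
    using class_sum[of "labellings D"] card_labellings[OF D(1)] by (simp add: D)
  define a where "a = infsum w {f \<in> ssyt l. \<not> inj_on f D}"
  define b where "b = infsum w Q"
  define p where "p = (of_nat (pdim l) / fact n :: complex)"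
  have "schur l x = of_nat (pdim l) * e + a"
    using split[OF ssyt] 1 by (simp add: schur_def w_def D_def a_def)
  moreover have "infsum x UNIV ^ n = fact n * e + b"
  proof -
    have "infsum w (extensional D) = infsum x UNIV ^ n"
      using infsum_prod_PiE_abs[OF D(1), of "\<lambda>_. x" "\<lambda>_. UNIV"] x
      by (simp add: PiE w_def D)
    then show ?thesis
      using split[of "extensional D"] 2 by (simp add: b_def Q_def)
  qed
  \<comment> \<open>Subtracting \<open>p\<close> times the second identity from the first eliminates
    the unknown \<open>e\<close>. Since \<open>pdim l \<le> fact n\<close>, the factor
    \<open>p\<close> does not enlarge the error \<open>b\<close>.\<close>
  ultimately have "schur l x - p * infsum x UNIV ^ n = a - p * b"
    by (simp add: p_def field_simps)
  moreover have "norm (a - p * b) \<le> B + 1 * B"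
  proof -
    have "norm a \<le> B" "norm b \<le> B"
      unfolding a_def b_def using ssyt by (auto intro!: small simp: Q_def)
    moreover have "norm p \<le> 1"
    proof -
      have "real (pdim l) \<le> real (fact (psize l))"
        using pdim_le_fact[OF l] by (simp only: of_nat_le_iff)
      then show ?thesis
        by (simp add: p_def n_def norm_divide)
    qed
    ultimately show ?thesis
      using norm_triangle_ineq4[of a "p * b"] mult_mono[of "norm p" 1 "norm b" B] norm_ge_zero[of b]
      by (simp add: norm_mult)
  qed
  ultimately show ?thesis
    by (simp add: p_def B_def)
qed

section \<open>Uniform bounds\<close>

text \<open>By Weierstrass's M-test the finite partial sums converge uniformly in those
  \<open>r\<close> where the majorant holds, hence the limits along \<open>F\<close> and along the
  finite subsets may be exchanged.\<close>

lemma infsum_dominated_convergence: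
  fixes f :: "'r \<Rightarrow> 'a \<Rightarrow> 'b :: banach" and M :: "'a \<Rightarrow> real"
  assumes F: "F \<noteq> bot" and M: "M summable_on A"
    and le: "\<forall>\<^sub>F r in F. \<forall>a\<in>A. norm (f r a) \<le> M a"
    and lim: "\<And>a. a \<in> A \<Longrightarrow> ((\<lambda>r. f r a) \<longlongrightarrow> g a) F"
  shows "\<forall>\<^sub>F r in F. f r summable_on A"
    and "g summable_on A"
    and "((\<lambda>r. infsum (f r) A) \<longlongrightarrow> infsum g A) F"
proof -
  have summable: "h summable_on A" if "\<And>a. a \<in> A \<Longrightarrow> norm (h a) \<le> M a" for h :: "'a \<Rightarrow> 'b"
    using Infinite_Sum.abs_summable_on_comparison_test'[OF M that] by (rule abs_summable_summable)
  show "\<forall>\<^sub>F r in F. f r summable_on A"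
    using le by eventually_elim (auto intro: summable)
  show g: "g summable_on A"
  proof (rule summable)
    fix a assume a: "a \<in> A"
    have "\<forall>\<^sub>F r in F. norm (f r a) \<le> M a"
      using le by eventually_elim (use a in blast)
    then show "norm (g a) \<le> M a"
      by (intro tendsto_upperbound[OF tendsto_norm[OF lim[OF a]]] F)
  qed
  have u: "uniform_limit {r. \<forall>a\<in>A. norm (f r a) \<le> M a} (\<lambda>B r. \<Sum>a\<in>B. f r a)
      (\<lambda>r. infsum (f r) A) (finite_subsets_at_top A)"
    by (rule Weierstrass_m_test_general[OF _ M]) auto
  show "((\<lambda>r. infsum (f r) A) \<longlongrightarrow> infsum g A) F"
  proof (rule swap_uniform_limit'[OF _ infsum_tendsto[OF g] u])
    show "\<forall>\<^sub>F B in finite_subsets_at_top A. ((\<lambda>r. \<Sum>a\<in>B. f r a) \<longlongrightarrow> sum g B) F"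
      by (intro eventually_finite_subsets_at_top_weakI tendsto_sum lim) auto
  qed (use le in auto)
qed

text \<open>With \<open>r\<close> as q^(1/2) this is the first power sum of the variables in
  \<open>Z_term\<close>. Its simple pole at \<open>r = 1\<close> is what the scaling by R will
  compensate.\<close>

lemma infsum_odd_powers:
  fixes r :: "'a :: {real_normed_field, banach}"
  assumes "norm r < 1"
  shows "(\<lambda>i. norm (r ^ (2 * i + 1))) summable_on UNIV" and "(\<Sum>\<^sub>\<infinity>i. r ^ (2 * i + 1)) = r / (1 - r\<^sup>2)"
proof -
  have sq: "norm (r\<^sup>2) < 1"
    using assms by (simp add: norm_power power_less_one_iff)
  have "summable (\<lambda>i. norm r * norm (r\<^sup>2) ^ i)"
    using sq by (intro summable_mult summable_geometric) auto
  then have s: "summable (\<lambda>i. norm (r ^ (2 * i + 1)))"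
    by (simp add: norm_mult norm_power power_mult)
  have "(\<lambda>i. r * (r\<^sup>2) ^ i) sums (r * (1 / (1 - r\<^sup>2)))"
    using sq by (intro sums_mult geometric_sums)
  then have "(\<lambda>i. r ^ (2 * i + 1)) sums (r / (1 - r\<^sup>2))"
    by (simp add: power_mult)
  then show "(\<Sum>\<^sub>\<infinity>i. r ^ (2 * i + 1)) = r / (1 - r\<^sup>2)"
    by (intro infsumI norm_summable_imp_has_sum s)
  show "(\<lambda>i. norm (r ^ (2 * i + 1))) summable_on UNIV"
    using s by (intro summable_nonneg_imp_summable_on) auto
qed

text \<open>A partition is determined by the differences \<open>l b - l (Suc b)\<close>, and the
  difference at \<open>b\<close> enters the first \<open>b + 1\<close> parts. This bounds the finite
  sums by Euler's product of the 1 / (1 - 4^(-k)), uniformly in the number \<open>N\<close> of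
  rows.\<close>

lemma summable_on_partitions: "(\<lambda>l. (1 / 4 :: real) ^ psize l) summable_on partitions"
proof (rule nonneg_bdd_above_summable_on)
  have "(\<Sum>l\<in>F. (1 / 4 :: real) ^ psize l) \<le> 3 / 2" if F: "F \<subseteq> partitions" "finite F" for F
  proof -
    have "finite (\<Union>l\<in>F. {i. l i \<noteq> 0})"
      using F by (auto simp: partitions_def)
    then obtain N where N: "\<And>l i. l \<in> F \<Longrightarrow> l i \<noteq> 0 \<Longrightarrow> i < N"
      unfolding finite_nat_set_iff_bounded by blast
    have psize: "psize l = (\<Sum>i<N. l i)" if "l \<in> F" for l
      unfolding psize_def using N[OF that] by (intro sum.mono_neutral_left) auto
    have card: "card {c \<in> {..<N}. c \<le> b} = Suc b" if "b < N" for b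
    proof -
      have "{c \<in> {..<N}. c \<le> b} = {..b}"
        using that by auto
      then show ?thesis
        by simp
    qed
    have parts: "l i = (\<Sum>b | b \<in> {..<N} \<and> i \<le> b. l b - l (Suc b))" if l: "l \<in> F" "i < N" for l i
    proof -
      have anti: "l \<in> partitions"
        using l F by auto
      have "l i = (\<Sum>b\<in>{i..<n}. l b - l (Suc b)) + l n" if "i \<le> n" for n
        using that
      proof (induction n rule: dec_induct)
        case (step n)
        then show ?case
          using partitions_antimonoD[OF anti, of n "Suc n"] by simp
      qed simp
      moreover have "{b \<in> {..<N}. i \<le> b} = {i..<N}"
        by auto
      moreover have "l N = 0"
        using N[OF l(1), of N] by auto
      ultimately show ?thesis
        using l(2) by (metis add_0_right less_imp_le)
    qed
    have "(\<Sum>l\<in>F. (1 / 4 :: real) ^ psize l) = (\<Sum>\<^sub>\<infinity>l\<in>F. (1 / 4) ^ (\<Sum>i<N. l i))"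
      using F psize by simp
    also have "\<dots> \<le> (\<Prod>b<N. 1 / (1 - (1 / 4) ^ card {c \<in> {..<N}. c \<le> b}))"
    proof (rule conjunct2[OF infsum_power_le_prod[where \<delta> = "\<lambda>l b. l b - l (Suc b)"]])
      fix l k assume lk: "l \<in> F" "k \<in> F" "\<And>c. c \<in> {..<N} \<Longrightarrow> l c = k c"
      show "l = k"
      proof
        fix i
        show "l i = k i"
          using N[OF lk(1), of i] N[OF lk(2), of i] lk(3)[of i] by (metis lessThan_iff)
      qed
    qed (use parts in auto)
    also have "\<dots> = 1 / (\<Prod>b<N. 1 - (1 / 4) ^ Suc b)"
      using card by (simp add: prod_dividef)
    \<comment> \<open>The product of the 1 - 4^(-k) is at least 1 minus the sum of the 4^(-k), and
      that sum stays below 1/3.\<close>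
    also have "\<dots> \<le> 1 / (2 / 3)"
    proof (rule divide_left_mono)
      have "(\<Sum>b<N. (1 / 4 :: real) ^ Suc b) = (1 - (1 / 4) ^ N) / 3"
      proof (induction N)
        case (Suc N)
        have "(\<Sum>b<Suc N. (1 / 4 :: real) ^ Suc b) = (1 - (1 / 4) ^ N) / 3 + (1 / 4) ^ Suc N"
          by (simp only: sum.lessThan_Suc Suc)
        then show ?case
          by simp
      qed simp
      then have "2 / 3 \<le> 1 - (\<Sum>b<N. (1 / 4 :: real) ^ Suc b)"
        by simp
      also have "\<dots> \<le> (\<Prod>b<N. 1 - (1 / 4) ^ Suc b)"
        by (rule Weierstrass_prod_ineq) (auto intro!: power_le_one simp del: power_Suc)
      finally show "2 / 3 \<le> (\<Prod>b<N. 1 - (1 / 4 :: real) ^ Suc b)" .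
      then show "0 < (\<Prod>b<N. 1 - (1 / 4 :: real) ^ Suc b) * (2 / 3)"
        by linarith
    qed auto
    finally show ?thesis
      by simp
  qed
  then show "bdd_above (sum (\<lambda>l. (1 / 4 :: real) ^ psize l) ` {F. F \<subseteq> partitions \<and> finite F})"
    by (intro bdd_aboveI[of _ "3 / 2"]) auto
qed simp

text \<open>One factor of the square is estimated along rows and the other along columns, so each
  cell gains from a long arm as well as from a long leg.\<close>

lemma norm_schur_sq_le:
  fixes r :: complex
  assumes l: "l \<in> partitions" and r: "norm r < 1"
  shows "norm (schur l (\<lambda>i. r ^ (2 * i + 1))) ^ 2 \<le>
    (\<Prod>b\<in>diagram l. 1 / (1 - (norm r ^ 2) ^ arm l b) * (1 / (1 - (norm r ^ 2) ^ leg l b)))"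
proof -
  let ?w = "\<lambda>T. \<Prod>c\<in>diagram l. r ^ (2 * T c + 1)"
  define S where "S = (\<Sum>\<^sub>\<infinity>T\<in>ssyt l. (norm r ^ 2) ^ (\<Sum>c\<in>diagram l. T c))"
  have z: "0 \<le> norm r ^ 2" "norm r ^ 2 < 1"
    using r by (auto simp: power_less_one_iff)
  have le: "norm (?w T) \<le> (norm r ^ 2) ^ (\<Sum>c\<in>diagram l. T c)" for T
  proof -
    have "norm (?w T) = (\<Prod>c\<in>diagram l. norm r * (norm r ^ 2) ^ T c)"
      by (simp add: prod_norm[symmetric] norm_mult norm_power power_mult)
    also have "\<dots> \<le> (\<Prod>c\<in>diagram l. 1 * (norm r ^ 2) ^ T c)"
      using r by (intro prod_mono conjI mult_right_mono) auto
    finally show ?thesis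
      by (simp add: power_sum)
  qed
  have sum: "(\<lambda>T. (norm r ^ 2) ^ (\<Sum>c\<in>diagram l. T c)) summable_on ssyt l"
    using infsum_ssyt_le_arm[OF l z] by blast
  have nsum: "(\<lambda>T. norm (?w T)) summable_on ssyt l"
    by (rule Infinite_Sum.abs_summable_on_comparison_test'[OF sum]) (rule le)
  have "norm (schur l (\<lambda>i. r ^ (2 * i + 1))) \<le> (\<Sum>\<^sub>\<infinity>T\<in>ssyt l. norm (?w T))"
    unfolding schur_def by (rule norm_infsum_bound[OF nsum])
  also have "\<dots> \<le> S"
    unfolding S_def using nsum sum le by (rule infsum_mono)
  finally have *: "norm (schur l (\<lambda>i. r ^ (2 * i + 1))) \<le> S" .
  then have "0 \<le> S"
    using norm_ge_zero order_trans by blast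
  have "norm (schur l (\<lambda>i. r ^ (2 * i + 1))) ^ 2 \<le> S * S"
    using power_mono[OF * norm_ge_zero, of 2] by (simp only: power2_eq_square)
  also have "\<dots> \<le> (\<Prod>b\<in>diagram l. 1 / (1 - (norm r ^ 2) ^ arm l b)) * (\<Prod>b\<in>diagram l. 1 / (1 - (norm r ^ 2) ^ leg l b))"
    using infsum_ssyt_le_arm[OF l z] infsum_ssyt_le_leg[OF l z] \<open>0 \<le> S\<close> unfolding S_def[symmetric]
    by (intro mult_mono) auto
  finally show ?thesis
    by (simp only: prod.distrib)
qed

lemma one_le_arm_leg:
  assumes "l \<in> partitions" "b \<in> diagram l"
  shows "1 \<le> arm l b" "1 \<le> leg l b"
proof -
  have b: "b \<in> {c \<in> diagram l. fst b = fst c \<and> snd b \<le> snd c}" "b \<in> {c \<in> diagram l. snd b = snd c \<and> fst b \<le> fst c}"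
    using assms by auto
  have "card {b} \<le> card {c \<in> diagram l. fst b = fst c \<and> snd b \<le> snd c}"
    "card {b} \<le> card {c \<in> diagram l. snd b = snd c \<and> fst b \<le> fst c}"
    using b finite_diagram[OF assms(1)] by (intro card_mono; simp)+
  then show "1 \<le> arm l b" "1 \<le> leg l b"
    unfolding arm_def leg_def by simp_all
qed

text \<open>With \<open>t = R * \<eta> * k\<close>, the inequality exp(-t) \<le> 1 / (1 + t) gives 1
  / (1 - exp(-t)) \<le> 1 + 1/t. Multiplication by \<open>R\<close> removes the pole at
  \<open>R = 0\<close> and keeps the decay in \<open>k\<close>.\<close>

lemma mult_inverse_one_minus_exp_le:
  fixes R \<eta> :: real
  assumes "0 < R" "0 < \<eta>" "1 \<le> k"
  shows "R * (1 / (1 - exp (- (R * \<eta>)) ^ k)) \<le> R + 1 / (\<eta> * k)"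
proof -
  define t where "t = R * \<eta> * k"
  have t: "0 < t"
    using assms by (simp add: t_def)
  have e: "exp (- (R * \<eta>)) ^ k = inverse (exp t)"
    by (simp add: t_def exp_minus power_inverse mult.commute flip: exp_of_nat_mult)
  have "inverse (exp t) \<le> inverse (1 + t)"
    using t by (intro le_imp_inverse_le) auto
  then have "t / (1 + t) \<le> 1 - inverse (exp t)"
    using t by (simp add: field_simps)
  moreover have "0 < t / (1 + t)"
    using t by simp
  ultimately have "1 / (1 - inverse (exp t)) \<le> 1 / (t / (1 + t))"
    by (intro divide_left_mono mult_pos_pos) linarith+
  then have "R * (1 / (1 - inverse (exp t))) \<le> R * (1 / (t / (1 + t)))"
    using assms by (intro mult_left_mono) auto
  also have "\<dots> = R + 1 / (\<eta> * k)"
    using assms by (simp add: t_def field_simps)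
  finally show ?thesis
    by (simp add: e)
qed

text \<open>A cell with a long arm or a long leg contributes at most 1/8. The other cells number at
  most a multiple of sqrt n + 1, where n is the size, and their bounded factors cost at most a
  constant times 2^n. This leaves a constant times (2/8)^n.\<close>

lemma prod_arm_leg_le:
  fixes \<eta> K :: real
  assumes \<eta>: "0 < \<eta>" and K: "0 \<le> K"
  obtains \<epsilon> C where "0 < \<epsilon>"
    "\<And>l. l \<in> partitions \<Longrightarrow>
      (\<Prod>b\<in>diagram l. K * ((\<epsilon> + 1 / (\<eta> * arm l b)) * (\<epsilon> + 1 / (\<eta> * leg l b)))) \<le> C * (1 / 4) ^ psize l"
proof -
  define M where "M = 1 + 1 / \<eta>"
  have M: "1 \<le> M"
    using \<eta> by (simp add: M_def)
  \<comment> \<open>Chosen so that \<open>K * (M * (2 * \<epsilon>))\<close> is K / (K + 1) times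
    1/8; adding 1 to \<open>K\<close> covers \<open>K = 0\<close>.\<close>
  define \<epsilon> where "\<epsilon> = 1 / (16 * (K + 1) * M)"
  have \<epsilon>: "0 < \<epsilon>" "\<epsilon> \<le> 1" "K * (M * (2 * \<epsilon>)) \<le> 1 / 8"
  proof -
    show "0 < \<epsilon>"
      using M K by (simp add: \<epsilon>_def)
    have "1 * 1 \<le> 16 * (K + 1) * M"
      using M K by (intro mult_mono) auto
    then show "\<epsilon> \<le> 1"
      by (simp add: \<epsilon>_def)
    have "K * (M * (2 * \<epsilon>)) = K / (K + 1) * (1 / 8)"
      using M K by (simp add: \<epsilon>_def divide_simps)
    also have "\<dots> \<le> 1 * (1 / 8)"
      using K by (intro mult_right_mono) auto
    finally show "K * (M * (2 * \<epsilon>)) \<le> 1 / 8"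
      by simp
  qed
  \<comment> \<open>From \<open>k = H\<close> on, \<open>1 / (\<eta> * k)\<close> is at most
    \<open>\<epsilon>\<close>, so \<open>g k\<close> is at most
    \<open>2 * \<epsilon>\<close>.\<close>
  define H where "H = nat \<lceil>1 / (\<eta> * \<epsilon>)\<rceil> + 1"
  define g where "g k = \<epsilon> + 1 / (\<eta> * real k)" for k :: nat
  have g0: "0 \<le> g k" for k
    using \<eta> \<epsilon> by (simp add: g_def)
  have gM: "g k \<le> M" if "1 \<le> k" for k
  proof -
    have "1 / (\<eta> * real k) \<le> 1 / (\<eta> * 1)"
      using that \<eta> by (intro divide_left_mono mult_left_mono) auto
    then show ?thesis
      using \<epsilon> by (simp add: g_def M_def)
  qed
  have gH: "g k \<le> 2 * \<epsilon>" if "H \<le> k" for k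
  proof -
    have "1 / (\<eta> * \<epsilon>) \<le> real k"
      using that unfolding H_def by linarith
    moreover have "0 < k"
      using that by (simp add: H_def)
    ultimately have "1 / (\<eta> * real k) \<le> \<epsilon>"
      using \<eta> \<epsilon> by (simp add: field_simps)
    then show ?thesis
      by (simp add: g_def)
  qed
  \<comment> \<open>The summand 1 keeps \<open>ln (8 * L)\<close> nonnegative also for small
    \<open>K\<close>.\<close>
  define L where "L = 1 + K * (M * M)"
  have L: "1 \<le> L"
    using K M by (simp add: L_def)
  define a where "a = 2 * real H * ln (8 * L)"
  have a: "0 \<le> a"
    using L by (simp add: a_def)
  have "(\<Prod>b\<in>diagram l. K * (g (arm l b) * g (leg l b))) \<le> exp (a\<^sup>2 + a) * (1 / 4) ^ psize l"
    if l: "l \<in> partitions" for l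
  proof -
    define n where "n = psize l"
    define D where "D = diagram l"
    define B where "B = {b \<in> D. arm l b < H \<and> leg l b < H}"
    have D: "finite D" "card D = n" "B \<subseteq> D"
      using l by (auto simp: D_def n_def B_def finite_diagram card_diagram)
    have factor: "K * (g (arm l b) * g (leg l b)) \<le> (if b \<in> B then 8 * L else 1) * (1 / 8)" if b: "b \<in> D" for b
    proof (cases "b \<in> B")
      case True
      have "K * (g (arm l b) * g (leg l b)) \<le> K * (M * M)"
        using one_le_arm_leg[OF l, of b] b K M g0 by (intro mult_left_mono mult_mono gM) (auto simp: D_def)
      then show ?thesis
        using True by (simp add: L_def)
    next
      case False
      then consider "H \<le> arm l b" | "H \<le> leg l b"
        using b by (auto simp: B_def)
      then have "g (arm l b) * g (leg l b) \<le> M * (2 * \<epsilon>)"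
      proof cases
        case 1
        then have "g (arm l b) * g (leg l b) \<le> (2 * \<epsilon>) * M"
          using one_le_arm_leg[OF l, of b] b g0 \<epsilon> by (intro mult_mono gH gM) (auto simp: D_def)
        then show ?thesis
          by (simp add: mult.commute)
      next
        case 2
        then show ?thesis
          using one_le_arm_leg[OF l, of b] b g0 \<epsilon> M by (intro mult_mono gH gM) (auto simp: D_def)
      qed
      then have "K * (g (arm l b) * g (leg l b)) \<le> K * (M * (2 * \<epsilon>))"
        using K by (intro mult_left_mono) auto
      then show ?thesis
        using False \<epsilon> by simp
    qed
    have "(\<Prod>b\<in>D. K * (g (arm l b) * g (leg l b))) \<le> (\<Prod>b\<in>D. (if b \<in> B then 8 * L else 1) * (1 / 8))"
      using factor K g0 by (intro prod_mono) auto
    also have "\<dots> = (8 * L) ^ card B * (1 / 8) ^ n"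
    proof -
      have "(\<Prod>b\<in>D. if b \<in> B then 8 * L else 1) = (8 * L) ^ card B"
        using prod.inter_restrict[OF D(1), of "\<lambda>_. 8 * L" B] D(3) by (simp add: Int_absorb1)
      then show ?thesis
        unfolding prod.distrib using D by simp
    qed
    also have "(8 * L) ^ card B \<le> exp (a\<^sup>2 + a) * 2 ^ n"
    proof -
      have "(8 * L) ^ card B = exp (real (card B) * ln (8 * L))"
        using L by (simp add: exp_of_nat_mult)
      also have "\<dots> \<le> exp (a * (sqrt n + 1))"
      proof -
        have "real (card B) * ln (8 * L) \<le> (2 * H * (sqrt n + 1)) * ln (8 * L)"
          using card_small_arm_leg[OF l, of H] L by (intro mult_right_mono) (auto simp: B_def D_def n_def)
        then show ?thesis
          by (simp add: a_def algebra_simps)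
      qed
      also have "\<dots> \<le> exp (a\<^sup>2 + a + real n * (1 / 4))"
      proof -
        \<comment> \<open>Expanding the square gives a sqrt n \<le> a^2 + n/4. The quarter suffices
          because exp(1/4) \<le> 2.\<close>
        have "0 \<le> (a - sqrt n / 2)\<^sup>2"
          by simp
        then show ?thesis
          by (simp add: power2_diff power_divide algebra_simps)
      qed
      also have "\<dots> = exp (a\<^sup>2 + a) * exp (1 / 4) ^ n"
        by (simp only: exp_add exp_of_nat_mult)
      also have "\<dots> \<le> exp (a\<^sup>2 + a) * 2 ^ n"
        using real_exp_bound_lemma[of "1 / 4"] by (intro mult_left_mono power_mono) auto
      finally show ?thesis .
    qed
    also have "exp (a\<^sup>2 + a) * 2 ^ n * (1 / 8) ^ n = exp (a\<^sup>2 + a) * (1 / 4) ^ n"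
      by (simp add: mult.assoc flip: power_mult_distrib)
    finally show ?thesis
      by (simp add: D_def n_def)
  qed
  with \<epsilon>(1) show ?thesis
    using that unfolding g_def by blast
qed

section \<open>Elementary limits as \<open>R\<close> tends to 0 from the right\<close>

lemma one_minus_exp_over_tendsto:
  "((\<lambda>R. (1 - exp (of_real R * a)) / of_real R) \<longlongrightarrow> - a) (at_right (0 :: real))" for a :: complex
proof (cases "a = 0")
  case False
  have "filterlim (\<lambda>R. of_real R * a) (at 0) (at_right (0 :: real))"
  proof (rule filterlim_atI)
    show "((\<lambda>R. of_real R * a) \<longlongrightarrow> 0) (at_right (0 :: real))"
      by (auto intro!: tendsto_eq_intros)
    show "\<forall>\<^sub>F R in at_right (0 :: real). of_real R * a \<noteq> 0"
      using eventually_at_right_less[of "0 :: real"] by eventually_elim (use False in auto)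
  qed
  from tendsto_mult[OF filterlim_compose[OF lim_exp_minus_1 this] tendsto_const[of "- a"]]
  have "((\<lambda>R. (exp (of_real R * a) - 1) / (of_real R * a) * (- a)) \<longlongrightarrow> 1 * (- a)) (at_right (0 :: real))" .
  moreover have "(\<lambda>R. (exp (of_real R * a) - 1) / (of_real R * a) * (- a)) = (\<lambda>R. (1 - exp (of_real R * a)) / of_real R)"
    using False by (auto simp: fun_eq_iff divide_simps)
  ultimately show ?thesis
    by simp
qed simp

lemma one_minus_exp_quotient_tendsto:
  fixes a b :: complex
  assumes "b \<noteq> 0"
  shows "((\<lambda>R. (1 - exp (of_real R * a)) / (1 - exp (of_real R * b))) \<longlongrightarrow> a / b) (at_right (0 :: real))"
proof -
  have "((\<lambda>R. ((1 - exp (of_real R * a)) / of_real R) / ((1 - exp (of_real R * b)) / of_real R)) \<longlongrightarrow> (- a) / (- b)) (at_right (0 :: real))"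
    using assms by (intro tendsto_divide one_minus_exp_over_tendsto) auto
  then have "((\<lambda>R. ((1 - exp (of_real R * a)) / of_real R) / ((1 - exp (of_real R * b)) / of_real R)) \<longlongrightarrow> a / b) (at_right (0 :: real))"
    by simp
  then show ?thesis
  proof (rule Lim_transform_eventually)
    show "\<forall>\<^sub>F R in at_right (0 :: real). ((1 - exp (of_real R * a)) / of_real R) / ((1 - exp (of_real R * b)) / of_real R)
        = (1 - exp (of_real R * a)) / (1 - exp (of_real R * b))"
      using eventually_at_right_less[of "0 :: real"] by eventually_elim auto
  qed
qed

section \<open>The limit\<close>

text \<open>The point is uniformity in \<open>i\<close>. For large \<open>i\<close> the real part of
  X + i h is at least 1, so the exponential has norm at most exp(-R) \<le> 1 - R/2. For the finitely
  many other \<open>i\<close>, the quotient by \<open>R\<close> tends to X + i h, which is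
  nonzero.\<close>

lemma one_minus_exp_lower_bound:
  fixes h X :: complex
  assumes h: "0 < Re h" and X: "\<And>n::nat. X \<noteq> - of_nat n * h"
  obtains c where "0 < c"
    "\<forall>\<^sub>F R in at_right 0. \<forall>i::nat. c * R \<le> norm (1 - exp (- (of_real R * (X + of_nat i * h))))"
proof -
  obtain N :: nat where N: "(1 - Re X) / Re h < real N"
    using reals_Archimedean2 by blast
  have nz: "X + of_nat i * h \<noteq> 0" for i
    using X[of i] by (simp add: eq_neg_iff_add_eq_0)
  \<comment> \<open>Half of each nonzero limit norm leaves room for the convergence at
    \<open>i < N\<close>; the entry 1/2 serves the tail and keeps the set nonempty.\<close>
  define c where "c = Min (insert (1 / 2) ((\<lambda>i. norm (X + of_nat i * h) / 2) ` {..<N}))"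
  have "0 < c"
    unfolding c_def using nz by (subst Min_gr_iff) auto
  have c: "c \<le> 1 / 2" "\<And>i. i < N \<Longrightarrow> c \<le> norm (X + of_nat i * h) / 2"
    unfolding c_def by (rule Min_le; simp)+
  have "\<forall>\<^sub>F R in at_right 0. c * R \<le> norm (1 - exp (- (of_real R * (X + of_nat i * h))))" if "i < N" for i
  proof -
    let ?z = "X + of_nat i * h"
    have "((\<lambda>R. norm ((1 - exp (of_real R * - ?z)) / of_real R)) \<longlongrightarrow> norm (- (- ?z))) (at_right (0 :: real))"
      by (intro tendsto_norm one_minus_exp_over_tendsto)
    moreover have "norm ?z / 2 < norm (- (- ?z))"
      using nz[of i] zero_less_norm_iff[of ?z] unfolding minus_minus by linarith
    ultimately have "\<forall>\<^sub>F R in at_right (0 :: real). norm ?z / 2 < norm ((1 - exp (of_real R * - ?z)) / of_real R)"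
      by (rule order_tendstoD)
    then show ?thesis
      using eventually_at_right_less[of "0 :: real"]
    proof eventually_elim
      case (elim R)
      have "c * R \<le> norm ?z / 2 * R"
        using c(2)[OF that] elim by (intro mult_right_mono) auto
      also have "\<dots> \<le> norm ((1 - exp (of_real R * - ?z)) / of_real R) * R"
        using elim by (intro mult_right_mono) auto
      also have "\<dots> = norm (1 - exp (- (of_real R * ?z)))"
        using elim unfolding mult_minus_right norm_divide by simp
      finally show ?case .
    qed
  qed
  then have small: "\<forall>\<^sub>F R in at_right 0. \<forall>i\<in>{..<N}. c * R \<le> norm (1 - exp (- (of_real R * (X + of_nat i * h))))"
    by (intro eventually_ball_finite) auto
  have "\<forall>\<^sub>F R in at_right (0 :: real). R < 1"
    by (intro eventually_at_rightI[of 0 1]) auto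
  with small have "\<forall>\<^sub>F R in at_right 0. \<forall>i::nat. c * R \<le> norm (1 - exp (- (of_real R * (X + of_nat i * h))))"
    using eventually_at_right_less[of "0 :: real"]
  proof eventually_elim
    case (elim R)
    show ?case
    proof
      fix i :: nat
      show "c * R \<le> norm (1 - exp (- (of_real R * (X + of_nat i * h))))"
      proof (cases "i < N")
        case False
        have "1 - Re X < real N * Re h"
          using N h by (simp add: pos_divide_less_eq)
        also have "\<dots> \<le> real i * Re h"
          using False h by (intro mult_right_mono) auto
        finally have "1 \<le> Re (X + of_nat i * h)"
          by simp
        then have "R * 1 \<le> R * Re (X + of_nat i * h)"
          using elim by (intro mult_left_mono) auto
        then have "norm (exp (- (of_real R * (X + of_nat i * h)))) \<le> exp (- R)"
          by simp
        also have "\<dots> \<le> 1 / (1 + R)"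
          using elim by (simp add: exp_minus inverse_eq_divide divide_left_mono)
        \<comment> \<open>(1 + R) (1 - R/2) = 1 + (R - R^2)/2, which is at least 1 because
          \<open>R < 1\<close>.\<close>
        also have "\<dots> \<le> 1 - R / 2"
        proof -
          have "R * R \<le> R * 1"
            using elim by (intro mult_left_mono) auto
          then show ?thesis
            using elim by (simp add: divide_simps algebra_simps)
        qed
        finally have "1 / 2 * R \<le> 1 - norm (exp (- (of_real R * (X + of_nat i * h))))"
          by simp
        also have "\<dots> \<le> norm (1 - exp (- (of_real R * (X + of_nat i * h))))"
          using norm_triangle_ineq2[of 1 "exp (- (of_real R * (X + of_nat i * h)))"] unfolding norm_one .
        finally have "1 / 2 * R \<le> norm (1 - exp (- (of_real R * (X + of_nat i * h))))" .
        moreover have "c * R \<le> 1 / 2 * R"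
          using elim by (intro mult_right_mono c) auto
        ultimately show ?thesis
          by (rule order_trans[rotated])
      qed (use elim in auto)
    qed
  qed
  with \<open>0 < c\<close> show ?thesis
    by (rule that)
qed

text \<open>With u = exp(R (X + i h)) and q = exp(-R h), the factor is (1 - u q^m) / (1 - u) = 1 +
  (1 - q^m) / (1/u - 1). The numerator is at most \<open>m\<close> times a multiple of
  \<open>R\<close> and the denominator at least \<open>c * R\<close>, so \<open>R\<close> cancels.
  The form \<open>exp (C * m)\<close> turns the product over the parts into a power with exponent
  \<open>psize l\<close>.\<close>

lemma shift_factor_bound:
  fixes h X :: complex
  assumes h: "0 < Re h" and X: "\<And>n::nat. X \<noteq> - of_nat n * h"
  obtains C :: real where
    "\<forall>\<^sub>F R in at_right 0. \<forall>i::nat. exp (of_real R * (X + of_nat i * h)) \<noteq> 1 \<and> (\<forall>m::nat.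
      norm ((1 - exp (of_real R * (X - (of_nat m - of_nat i) * h))) / (1 - exp (of_real R * (X + of_nat i * h))))
        \<le> exp (C * m))"
proof -
  obtain c where c: "0 < c"
    "\<forall>\<^sub>F R in at_right 0. \<forall>i::nat. c * R \<le> norm (1 - exp (- (of_real R * (X + of_nat i * h))))"
    using one_minus_exp_lower_bound[OF h X] by blast
  define C where "C = (norm h + 1) / c"
  have "((\<lambda>R. norm ((1 - exp (of_real R * - h)) / of_real R)) \<longlongrightarrow> norm (- (- h))) (at_right (0 :: real))"
    by (intro tendsto_norm one_minus_exp_over_tendsto)
  then have "\<forall>\<^sub>F R in at_right (0 :: real). norm ((1 - exp (of_real R * - h)) / of_real R) < norm h + 1"
    by (rule order_tendstoD) simp
  with c(2) have "\<forall>\<^sub>F R in at_right 0. \<forall>i::nat. exp (of_real R * (X + of_nat i * h)) \<noteq> 1 \<and> (\<forall>m::nat.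
      norm ((1 - exp (of_real R * (X - (of_nat m - of_nat i) * h))) / (1 - exp (of_real R * (X + of_nat i * h))))
        \<le> exp (C * m))"
    using eventually_at_right_less[of "0 :: real"]
  proof eventually_elim
    case (elim R)
    show ?case
    proof (intro allI conjI)
      fix i m :: nat
      define u where "u = exp (of_real R * (X + of_nat i * h))"
      define v where "v = exp (- (of_real R * (X + of_nat i * h)))"
      define q where "q = exp (of_real R * - h)"
      have uv: "u * v = 1"
        by (simp add: u_def v_def flip: exp_add)
      have v: "c * R \<le> norm (1 - v)" "0 < c * R"
        using elim c by (auto simp: v_def)
      then have "v \<noteq> 1"
        by auto
      then show u: "exp (of_real R * (X + of_nat i * h)) \<noteq> 1"
        using uv by (auto simp: u_def[symmetric])
      have q: "norm (1 - q) \<le> (norm h + 1) * R"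
        using elim by (simp add: q_def norm_divide field_simps)
      have "exp (of_real R * (X - (of_nat m - of_nat i) * h)) = u * q ^ m"
        by (simp add: u_def q_def algebra_simps flip: exp_add exp_of_nat_mult)
      moreover have "(1 - u * q ^ m) / (1 - u) = 1 + (1 - q ^ m) / (v - 1)"
      proof -
        have "v = 1 / u"
          using uv by (metis mult.commute div_by_0 mult_zero_left nonzero_mult_div_cancel_left zero_neq_one)
        moreover have "u \<noteq> 0" "u \<noteq> 1"
          using u by (auto simp: u_def)
        ultimately show ?thesis
          using \<open>v \<noteq> 1\<close> by (simp add: divide_simps) (simp add: algebra_simps)
      qed
      moreover have "norm (1 + (1 - q ^ m) / (v - 1)) \<le> exp (C * m)"
      proof -
        have "norm q \<le> 1"
          using elim h by (simp add: q_def)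
        then have "norm (1 - q ^ m) \<le> m * norm (1 - q)"
          using norm_power_diff[of 1 q m] by simp
        also have "\<dots> \<le> m * ((norm h + 1) * R)"
          using q by (intro mult_left_mono) auto
        finally have "norm (1 - q ^ m) / norm (v - 1) \<le> (m * ((norm h + 1) * R)) / (c * R)"
          using v elim by (intro frac_le mult_nonneg_nonneg) (auto simp: norm_minus_commute)
        also have "\<dots> = C * m"
          using elim by (simp add: C_def)
        finally have "norm (1 + (1 - q ^ m) / (v - 1)) \<le> 1 + C * m"
          using norm_triangle_ineq[of 1 "(1 - q ^ m) / (v - 1)"] by (simp add: norm_divide)
        also have "\<dots> \<le> exp (C * m)"
          by (rule exp_ge_add_one_self)
        finally show ?thesis .
      qed
      ultimately show "norm ((1 - exp (of_real R * (X - (of_nat m - of_nat i) * h))) / (1 - exp (of_real R * (X + of_nat i * h))))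
        \<le> exp (C * m)"
        by (simp add: u_def)
    qed
  qed
  then show ?thesis
    by (rule that)
qed

text \<open>The scaled first power sum tends to 1/h and its n-th power yields the limit. The error
  from \<open>norm_schur_diff_le\<close>, scaled by R^n, keeps a spare factor R, since non-injective
  fillings have one free summation fewer.\<close>

lemma schur_scaled_tendsto:
  fixes h :: complex
  assumes h: "0 < Re h" and l: "l \<in> partitions"
  shows "((\<lambda>R. of_real R ^ psize l * schur l (\<lambda>i. exp (- (of_real R * h / 2)) ^ (2 * i + 1)))
    \<longlongrightarrow> of_nat (pdim l) / fact (psize l) * (1 / h) ^ psize l) (at_right 0)"
proof -
  define n where "n = psize l"
  define r where "r R = exp (- (of_real R * h / 2))" for R :: real
  \<comment> \<open>\<open>s R\<close> is the first power sum of the variables, \<open>p R\<close>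
    that of their norms, which governs the error.\<close>
  define p where "p R = norm (r R) / (1 - (norm (r R))\<^sup>2)" for R
  define s where "s R = r R / (1 - (r R)\<^sup>2)" for R
  have r2: "(r R)\<^sup>2 = exp (of_real R * - h)" for R
    by (simp add: r_def power2_eq_square mult.commute flip: exp_add)
  have nr2: "(norm (r R))\<^sup>2 = norm (exp (of_real R * - of_real (Re h) :: complex))" for R
    by (simp add: r_def power2_eq_square flip: exp_add)
  have r1: "norm (r R) < 1" if "0 < R" for R
    using that h by (simp add: r_def)
  have r_lim: "(r \<longlongrightarrow> 1) (at_right 0)"
    unfolding r_def by (auto intro!: tendsto_eq_intros)
  have s_lim: "((\<lambda>R. of_real R * s R) \<longlongrightarrow> 1 / h) (at_right 0)"
  proof -
    have "((\<lambda>R. r R / ((1 - exp (of_real R * - h)) / of_real R)) \<longlongrightarrow> 1 / (- (- h))) (at_right 0)"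
      using h by (intro tendsto_divide r_lim one_minus_exp_over_tendsto) auto
    then show ?thesis
      by (simp add: s_def r2 mult.commute)
  qed
  have p_lim: "((\<lambda>R. R * p R) \<longlongrightarrow> 1 / Re h) (at_right 0)"
  proof -
    have "((\<lambda>R. of_real (norm (r R)) / ((1 - exp (of_real R * - of_real (Re h))) / of_real R)) \<longlongrightarrow> of_real (norm (1 :: complex)) / (- (- of_real (Re h) :: complex))) (at_right 0)"
      using h by (intro tendsto_divide tendsto_of_real tendsto_norm r_lim one_minus_exp_over_tendsto) auto
    moreover have "of_real (norm (r R)) / ((1 - exp (of_real R * - of_real (Re h))) / of_real R) = (of_real (R * p R) :: complex)" for R
    proof -
      have "exp (of_real R * - of_real (Re h)) = (of_real ((norm (r R))\<^sup>2) :: complex)"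
        unfolding nr2 by (simp flip: exp_of_real)
      then show ?thesis
        by (simp add: p_def mult.commute)
    qed
    ultimately have "((\<lambda>R. of_real (R * p R) :: complex) \<longlongrightarrow> of_real (1 / Re h)) (at_right 0)"
      by simp
    then show ?thesis
      by (simp only: tendsto_of_real_iff)
  qed
  define e where "e R = of_real R ^ n * schur l (\<lambda>i. r R ^ (2 * i + 1)) - of_nat (pdim l) / fact n * (of_real R * s R) ^ n" for R
  have "\<forall>\<^sub>F R in at_right 0. norm (e R) \<le> 2 * real (n\<^sup>2) * (R * (R * p R) ^ (n - 1))"
    using eventually_at_right_less[of "0 :: real"]
  proof eventually_elim
    case (elim R)
    note r1[OF elim]
    then have nr: "norm (norm (r R)) < 1"
      by simp
    have "norm (r R ^ (2 * i + 1)) \<le> 1" for i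
      using r1[OF elim] unfolding norm_power by (intro power_le_one) auto
    then have "norm (schur l (\<lambda>i. r R ^ (2 * i + 1)) - of_nat (pdim l) / fact n * s R ^ n) \<le> 2 * real (n\<^sup>2) * p R ^ (n - 1)"
      using norm_schur_diff_le[OF l infsum_odd_powers(1)[OF r1[OF elim]]] infsum_odd_powers(2)[OF r1[OF elim]]
        infsum_odd_powers(2)[OF nr]
      unfolding n_def s_def p_def norm_power by simp
    then have "R ^ n * norm (schur l (\<lambda>i. r R ^ (2 * i + 1)) - of_nat (pdim l) / fact n * s R ^ n) \<le> R ^ n * (2 * real (n\<^sup>2) * p R ^ (n - 1))"
      using elim by (intro mult_left_mono) auto
    \<comment> \<open>For \<open>n = 0\<close> the truncated exponent \<open>n - 1\<close> is
      harmless, as both sides vanish through the factor n^2.\<close>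
    also have "R ^ n * (2 * real (n\<^sup>2) * p R ^ (n - 1)) = 2 * real (n\<^sup>2) * (R * (R * p R) ^ (n - 1))"
      by (cases n) (auto simp: power_mult_distrib)
    also have "R ^ n * norm (schur l (\<lambda>i. r R ^ (2 * i + 1)) - of_nat (pdim l) / fact n * s R ^ n) = norm (e R)"
    proof -
      have "e R = of_real R ^ n * (schur l (\<lambda>i. r R ^ (2 * i + 1)) - of_nat (pdim l) / fact n * s R ^ n)"
        by (simp add: e_def power_mult_distrib right_diff_distrib mult_ac)
      then show ?thesis
        using elim by (simp only: norm_mult norm_power norm_of_real abs_of_pos)
    qed
    finally show ?case .
  qed
  moreover have "((\<lambda>R. 2 * real (n\<^sup>2) * (R * (R * p R) ^ (n - 1))) \<longlongrightarrow> 2 * real (n\<^sup>2) * (0 * (1 / Re h) ^ (n - 1))) (at_right 0)"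
    by (intro tendsto_mult tendsto_power p_lim tendsto_const tendsto_ident_at)
  ultimately have "(e \<longlongrightarrow> 0) (at_right 0)"
    unfolding mult_zero_left mult_zero_right by (rule Lim_null_comparison)
  moreover have "((\<lambda>R. of_nat (pdim l) / fact n * (of_real R * s R) ^ n) \<longlongrightarrow> of_nat (pdim l) / fact n * (1 / h) ^ n) (at_right 0)"
    by (intro tendsto_mult tendsto_power s_lim tendsto_const)
  ultimately have "((\<lambda>R. e R + of_nat (pdim l) / fact n * (of_real R * s R) ^ n) \<longlongrightarrow> 0 + of_nat (pdim l) / fact n * (1 / h) ^ n) (at_right 0)"
    by (rule tendsto_add)
  then show ?thesis
    by (simp add: e_def r_def n_def)
qed

theorem lemma6:
  fixes h \<Lambda> X :: complex and q_half Q x :: "real \<Rightarrow> complex"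
  assumes "Re h > 0"
    and "\<And>n::nat. X \<noteq> - of_nat n * h"
    and "\<And>R. q_half R = exp (- (of_real R * h / 2))"
    and "\<And>R. Q R = (of_real R * \<Lambda>)\<^sup>2"
    and "\<And>R. x R = exp (of_real R * (X - h / 2))"
  shows "(\<forall>\<^sub>F R in at_right 0. Z_term (q_half R) (Q R) (x R) summable_on partitions) \<and>
         Z4D_term h \<Lambda> X summable_on partitions \<and>
         ((\<lambda>R. Z (q_half R) (Q R) (x R)) \<longlongrightarrow> Z4D h \<Lambda> X) (at_right 0)"
proof -
  note h = assms(1) and X = assms(2) and q = assms(3) and Q = assms(4) and x = assms(5)
  define S where "S R l = schur l (\<lambda>i. q_half R ^ (2 * i + 1))" for R l
  define f where "f R i m = (1 - exp (of_real R * (X - (of_nat m - of_nat i) * h))) / (1 - exp (of_real R * (X + of_nat i * h)))"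
    for R and i m :: nat
  define f0 where "f0 i m = (X - (of_nat m - of_nat i) * h) / (X + of_nat i * h)" for i m :: nat
  have nz: "X + of_nat i * h \<noteq> 0" for i
    using X[of i] by (simp add: eq_neg_iff_add_eq_0)
  \<comment> \<open>The exponents \<open>k\<close> that occur are odd; the factor q^(1/2) inside
    \<open>x R\<close> shifts k/2 to the integer (k + 1)/2.\<close>
  have q_powi: "q_half R powi k * x R = exp (of_real R * (X - of_int (k + 1) / 2 * h))" for R k
    unfolding q x exp_power_int exp_add[symmetric]
    by (rule arg_cong[where f = exp]) (simp add: field_simps)
  have factor: "(1 - q_half R powi (2 * (int m - int (i + 1)) + 1) * x R) / (1 - q_half R powi (2 * (- int (i + 1)) + 1) * x R) = f R i m" for R i m
  proof -
    have e: "of_int (2 * (int m - int (i + 1)) + 1 + 1) / 2 = (of_nat m - of_nat i :: complex)"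
      "of_int (2 * (- int (i + 1)) + 1 + 1) / 2 = (- of_nat i :: complex)"
      by (simp_all add: field_simps)
    show ?thesis
      unfolding q_powi f_def e by simp
  qed
  have factor0: "(X - of_int (int m - int (i + 1) + 1) * h) / (X - of_int (- int (i + 1) + 1) * h) = f0 i m" for i m
    unfolding f0_def by (simp add: algebra_simps)
  obtain C :: real where C: "\<forall>\<^sub>F R in at_right 0. \<forall>i::nat. exp (of_real R * (X + of_nat i * h)) \<noteq> 1 \<and> (\<forall>m::nat. norm (f R i m) \<le> exp (C * m))"
    using shift_factor_bound[OF h X] unfolding f_def by blast
  \<comment> \<open>The share of each cell apart from the Schur function: \<open>exp C\<close> from
    the product over the parts and the squared norm of \<open>\<Lambda>\<close> from
    \<open>Q R\<close>, whose R^2 is kept for the arm and leg factors.\<close>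
  define K where "K = exp C * norm \<Lambda> ^ 2"
  have K: "0 \<le> K"
    by (simp add: K_def)
  obtain \<epsilon> C' where \<epsilon>: "0 < \<epsilon>" "\<And>l. l \<in> partitions \<Longrightarrow>
      (\<Prod>b\<in>diagram l. K * ((\<epsilon> + 1 / (Re h * arm l b)) * (\<epsilon> + 1 / (Re h * leg l b)))) \<le> C' * (1 / 4) ^ psize l"
    using prod_arm_leg_le[OF h K] by blast
  \<comment> \<open>An empty row gives the factor 1 only if its denominator is nonzero, as division
    by 0 yields 0; hence the assumption on \<open>R\<close>. The powers of R in \<open>Q R\<close>
    move into the square, where they balance the growth of the Schur function.\<close>
  have term_eq: "Z_term (q_half R) (Q R) (x R) l = (of_real R ^ psize l * S R l)\<^sup>2 * \<Lambda> ^ (2 * psize l) * (\<Prod>i | l i \<noteq> 0. f R i (l i))"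
    if l: "l \<in> partitions" and R: "\<And>i::nat. exp (of_real R * (X + of_nat i * h)) \<noteq> 1" for R l
  proof -
    have "(\<Prod>i. f R i (l i)) = (\<Prod>i | l i \<noteq> 0. f R i (l i))"
      using l R by (intro prodinf_finite) (auto simp: partitions_def f_def)
    then show ?thesis
      unfolding Z_term_def factor Q S_def by (simp add: power_mult_distrib mult_ac flip: power_mult)
  qed
  have term0_eq: "Z4D_term h \<Lambda> X l = (of_nat (pdim l) / fact (psize l) * (1 / h) ^ psize l)\<^sup>2 * \<Lambda> ^ (2 * psize l) * (\<Prod>i | l i \<noteq> 0. f0 i (l i))"
    if l: "l \<in> partitions" for l
  proof -
    have "(\<Prod>i. f0 i (l i)) = (\<Prod>i | l i \<noteq> 0. f0 i (l i))"
      using l nz by (intro prodinf_finite) (auto simp: partitions_def f0_def)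
    then show ?thesis
      unfolding Z4D_term_def factor0 by (simp add: power_mult_distrib power_divide mult_ac flip: power_mult)
  qed
  have bound: "\<forall>\<^sub>F R in at_right 0. \<forall>l\<in>partitions. norm (Z_term (q_half R) (Q R) (x R) l) \<le> C' * (1 / 4) ^ psize l"
  proof -
    \<comment> \<open>The leftover summand \<open>R\<close> in
      \<open>mult_inverse_one_minus_exp_le\<close> may then be replaced by
      \<open>\<epsilon>\<close>, which makes the majorant independent of \<open>R\<close>.\<close>
    have "\<forall>\<^sub>F R in at_right (0 :: real). R < \<epsilon>"
      using \<epsilon>(1) by (intro eventually_at_rightI[of 0 \<epsilon>]) auto
    with C show ?thesis
      using eventually_at_right_less[of "0 :: real"]
    proof eventually_elim
      case (elim R)
      show ?case
      proof
        fix l assume l: "l \<in> partitions"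
        let ?n = "psize l" and ?D = "diagram l"
        define z where "z = exp (- (R * Re h))"
        \<comment> \<open>The R^2 available at each cell is split evenly, one \<open>R\<close> for
          the arm and one for the leg.\<close>
        define G where "G = (\<Prod>b\<in>?D. (R * (1 / (1 - z ^ arm l b))) * (R * (1 / (1 - z ^ leg l b))))"
        have r: "norm (q_half R) < 1" "norm (q_half R) ^ 2 = z"
          using elim h by (auto simp: q z_def power2_eq_square simp flip: exp_add)
        have "norm (\<Prod>i | l i \<noteq> 0. f R i (l i)) \<le> (\<Prod>i | l i \<noteq> 0. exp (C * l i))"
          unfolding prod_norm[symmetric] using elim by (intro prod_mono) auto
        also have "\<dots> = exp C ^ ?n"
          using l by (simp add: psize_def partitions_def exp_sum[symmetric] sum_distrib_left[symmetric] mult.commute flip: exp_of_nat_mult)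
        finally have "norm (\<Prod>i | l i \<noteq> 0. f R i (l i)) \<le> exp C ^ ?n" .
        moreover have "norm ((of_real R ^ ?n * S R l)\<^sup>2) \<le> G"
        proof -
          have "norm ((of_real R ^ ?n * S R l)\<^sup>2) = (R * R) ^ ?n * norm (S R l) ^ 2"
            using elim by (simp add: norm_mult norm_power power_mult_distrib power2_eq_square)
          also have "\<dots> \<le> (R * R) ^ ?n * (\<Prod>b\<in>?D. 1 / (1 - z ^ arm l b) * (1 / (1 - z ^ leg l b)))"
            using norm_schur_sq_le[OF l r(1)] unfolding r(2) S_def by (intro mult_left_mono) auto
          also have "\<dots> = (\<Prod>b\<in>?D. (R * R) * (1 / (1 - z ^ arm l b) * (1 / (1 - z ^ leg l b))))"
            by (simp only: prod.distrib[of "\<lambda>_. R * R"] prod_constant card_diagram[OF l])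
          also have "\<dots> = G"
            unfolding G_def by (intro prod.cong refl) (simp only: mult_ac)
          finally show ?thesis .
        qed
        moreover have "norm (Z_term (q_half R) (Q R) (x R) l) = norm ((of_real R ^ ?n * S R l)\<^sup>2) * (norm \<Lambda> ^ 2) ^ ?n * norm (\<Prod>i | l i \<noteq> 0. f R i (l i))"
          using elim l by (subst term_eq) (auto simp: norm_mult norm_power simp flip: power_mult)
        ultimately have "norm (Z_term (q_half R) (Q R) (x R) l) \<le> G * (norm \<Lambda> ^ 2) ^ ?n * exp C ^ ?n"
          using order_trans[OF norm_ge_zero] by (auto intro!: mult_mono)
        also have "\<dots> = K ^ ?n * G"
          by (simp add: K_def power_mult_distrib mult_ac)
        also have "\<dots> = (\<Prod>b\<in>?D. K * ((R * (1 / (1 - z ^ arm l b))) * (R * (1 / (1 - z ^ leg l b)))))"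
          unfolding G_def by (simp only: prod.distrib[of "\<lambda>_. K"] prod_constant card_diagram[OF l])
        also have "\<dots> \<le> (\<Prod>b\<in>?D. K * ((\<epsilon> + 1 / (Re h * arm l b)) * (\<epsilon> + 1 / (Re h * leg l b))))"
        proof (intro prod_mono conjI)
          fix b assume b: "b \<in> ?D"
          have z1: "0 \<le> 1 / (1 - z ^ k)" for k
            using elim h by (simp add: z_def power_le_one)
          have g: "0 \<le> R * (1 / (1 - z ^ k))" "1 \<le> k \<Longrightarrow> R * (1 / (1 - z ^ k)) \<le> \<epsilon> + 1 / (Re h * k)" for k
            using mult_inverse_one_minus_exp_le[of R "Re h" k] elim h z1[of k] by (auto simp: z_def)
          note ga = g(2)[OF one_le_arm_leg(1)[OF l b]] and gl = g(2)[OF one_le_arm_leg(2)[OF l b]]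
          show "0 \<le> K * (R * (1 / (1 - z ^ arm l b)) * (R * (1 / (1 - z ^ leg l b))))"
            by (intro mult_nonneg_nonneg[OF K] mult_nonneg_nonneg[OF g(1) g(1)])
          show "K * (R * (1 / (1 - z ^ arm l b)) * (R * (1 / (1 - z ^ leg l b)))) \<le>
              K * ((\<epsilon> + 1 / (Re h * arm l b)) * (\<epsilon> + 1 / (Re h * leg l b)))"
            by (rule mult_left_mono[OF mult_mono[OF ga gl order_trans[OF g(1) ga] g(1)] K])
        qed
        also have "\<dots> \<le> C' * (1 / 4) ^ ?n"
          by (rule \<epsilon>(2)[OF l])
        finally show "norm (Z_term (q_half R) (Q R) (x R) l) \<le> C' * (1 / 4) ^ ?n" .
      qed
    qed
  qed
  have lim: "((\<lambda>R. Z_term (q_half R) (Q R) (x R) l) \<longlongrightarrow> Z4D_term h \<Lambda> X l) (at_right 0)"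
    if l: "l \<in> partitions" for l
  proof -
    have "((\<lambda>R. f R i (l i)) \<longlongrightarrow> f0 i (l i)) (at_right 0)" for i
      unfolding f_def f0_def by (rule one_minus_exp_quotient_tendsto[OF nz])
    then have "((\<lambda>R. (of_real R ^ psize l * S R l)\<^sup>2 * \<Lambda> ^ (2 * psize l) * (\<Prod>i | l i \<noteq> 0. f R i (l i)))
        \<longlongrightarrow> Z4D_term h \<Lambda> X l) (at_right 0)"
      unfolding term0_eq[OF l] S_def q
      by (intro tendsto_mult tendsto_power tendsto_prod tendsto_const schur_scaled_tendsto[OF h l])
    then show ?thesis
    proof (rule Lim_transform_eventually)
      show "\<forall>\<^sub>F R in at_right 0. (of_real R ^ psize l * S R l)\<^sup>2 * \<Lambda> ^ (2 * psize l) * (\<Prod>i | l i \<noteq> 0. f R i (l i))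
          = Z_term (q_half R) (Q R) (x R) l"
        using C by eventually_elim (use term_eq[OF l] in auto)
    qed
  qed
  have M: "(\<lambda>l. C' * (1 / 4) ^ psize l) summable_on partitions"
    by (intro summable_on_cmult_right summable_on_partitions)
  \<comment> \<open>The same majorant yields both summability claims, so the limit is not about the
    default value 0 of \<open>infsum\<close>.\<close>
  show ?thesis
    unfolding Z_def Z4D_def
    by (intro conjI infsum_dominated_convergence[OF trivial_limit_at_right_real M bound lim])
qed

end
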